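(* Let $R$ be a relational structure whose age is inexhaustible and let $k$ be a non-negative integer. If $\varphi_R$ has polynomial growth of degree $k$, then $\varphi_R(n)\leq\binom{n+k}{k}$ for every non-negative integer $n$.
   Context: Relational structure $R=(E,(\rho_i)_{i\in I})$ with $\rho_i\subseteq E^{m_i}$; age $\mathcal{A}(R)$ = set of isomorphism types of finite induced substructures; profile $\varphi_R(n)$ = number of isomorphism types of $n$-element induced substructures. The age is inexhaustible if any two members embed into a third member with disjoint images (equivalently $\{x\in E:\mathcal{A}(R_{\restriction E\setminus\{x\}})\neq\mathcal{A}(R)\}=\emptyset$). $\varphi$ has polynomial growth of degree $k$ if there are reals $a,b>0$ with $an^k\le\varphi(n)\le bn^k$ for all sufficiently large $n$. *)

theory Defs
  imports "HOL-Library.Extended_Real"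
begin

text \<open>Tuples in \<open>E\<^sup>m\<close> are lists of length \<open>m\<close>. The index set \<open>I\<close> may be empty or infinite, and
  the fields \<open>arity\<close> and \<open>rel\<close> carry no information outside it.\<close>

record ('a, 'i) rel_struct =
  univ :: "'a set"
  index :: "'i set"
  arity :: "'i \<Rightarrow> nat"
  rel :: "'i \<Rightarrow> 'a list set"

definition tuples :: "'a set \<Rightarrow> nat \<Rightarrow> 'a list set" where
  "tuples E m = {xs. set xs \<subseteq> E \<and> length xs = m}"

definition relational_structure :: "('a, 'i) rel_struct \<Rightarrow> bool" where
  "relational_structure R \<longleftrightarrow> (\<forall>i\<in>index R. rel R i \<subseteq> tuples (univ R) (arity R i))"

definition induced :: "('a, 'i) rel_struct \<Rightarrow> 'a set \<Rightarrow> ('a, 'i) rel_struct" where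
  "induced R A = R\<lparr>univ := A, rel := \<lambda>i. rel R i \<inter> tuples A (arity R i)\<rparr>"

definition same_signature :: "('a, 'i) rel_struct \<Rightarrow> ('b, 'i) rel_struct \<Rightarrow> bool" where
  "same_signature S T \<longleftrightarrow> index S = index T \<and> (\<forall>i\<in>index S. arity S i = arity T i)"

definition embedding :: "('a \<Rightarrow> 'b) \<Rightarrow> ('a, 'i) rel_struct \<Rightarrow> ('b, 'i) rel_struct \<Rightarrow> bool" where
  "embedding f S T \<longleftrightarrow>
     same_signature S T \<and> inj_on f (univ S) \<and> f ` univ S \<subseteq> univ T \<and>
     (\<forall>i\<in>index S. \<forall>xs\<in>tuples (univ S) (arity S i). xs \<in> rel S i \<longleftrightarrow> map f xs \<in> rel T i)"

definition isomorphic :: "('a, 'i) rel_struct \<Rightarrow> ('b, 'i) rel_struct \<Rightarrow> bool" where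
  "isomorphic S T \<longleftrightarrow> (\<exists>f. embedding f S T \<and> f ` univ S = univ T)"

text \<open>The isomorphism type is taken among structures on subsets of the same ground type \<open>'a\<close>, which
  contains representatives of all types occurring in an age over \<open>'a\<close>.\<close>

definition iso_type :: "('a, 'i) rel_struct \<Rightarrow> ('a, 'i) rel_struct set" where
  "iso_type S = {T. relational_structure T \<and> isomorphic S T}"

definition age :: "('a, 'i) rel_struct \<Rightarrow> ('a, 'i) rel_struct set set" where
  "age R = {iso_type (induced R A) |A. A \<subseteq> univ R \<and> finite A}"

definition inexhaustible :: "('a, 'i) rel_struct set set \<Rightarrow> bool" where
  "inexhaustible \<A> \<longleftrightarrow>
     (\<forall>\<sigma>\<in>\<A>. \<forall>\<tau>\<in>\<A>. \<forall>S\<in>\<sigma>. \<forall>T\<in>\<tau>. \<exists>\<upsilon>\<in>\<A>. \<exists>U\<in>\<upsilon>. \<exists>f g.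
        embedding f S U \<and> embedding g T U \<and> f ` univ S \<inter> g ` univ T = {})"

text \<open>Extended values are needed because, for infinite \<open>I\<close>, there can be infinitely many
  isomorphism types of a given size, a case in which \<open>card\<close> would return \<open>0\<close>.\<close>

definition profile :: "('a, 'i) rel_struct \<Rightarrow> nat \<Rightarrow> enat" where
  "profile R n =
     (let \<T> = {iso_type (induced R A) |A. A \<subseteq> univ R \<and> finite A \<and> card A = n}
      in if finite \<T> then enat (card \<T>) else \<infinity>)"

definition polynomial_growth :: "(nat \<Rightarrow> enat) \<Rightarrow> nat \<Rightarrow> bool" where
  "polynomial_growth \<phi> k \<longleftrightarrow>
     (\<exists>a b :: real. a > 0 \<and> b > 0 \<and>
        (\<forall>\<^sub>F n in sequentially.
           ereal (a * real n ^ k) \<le> ereal_of_enat (\<phi> n) \<and>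
           ereal_of_enat (\<phi> n) \<le> ereal (b * real n ^ k)))"

end

theory Submission
  imports Defs "HOL-Library.Ramsey" "HOL-Library.FuncSet"
begin

text \<open>In Cameron's age algebra the degree \<open>n\<close> component consists of the functions on \<open>n\<close>-element
  subsets that are constant on isomorphism types, so its dimension is \<open>\<phi> n\<close>. Let \<open>F\<close> be a finite
  substructure that realizes all types of size \<open>n\<close>. By inexhaustibility there are infinitely many
  disjoint copies of \<open>F\<close>, and by Ramsey's theorem the type of a set assembled from subsets of the
  copies depends only on the word of these subsets. Evaluating an age function at the words
  \<open>C\<^sub>1 ^ a\<^sub>1 \<dots> C\<^sub>s ^ a\<^sub>s\<close>, for a sequence \<open>C\<^sub>1, \<dots>, C\<^sub>s\<close> containing all short words as subsequences,
  gives the function a leading exponent vector, as for polynomials: first the length, then the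
  lexicographic order. Leads are additive, and the number of leads of degree \<open>m\<close> is at most \<open>\<phi> m\<close>,
  with equality for \<open>m = n\<close>.

  The leads of degree \<open>n\<close> are vectors of naturals with coordinate sum at most \<open>n\<close>. If their affine
  hull has dimension at most \<open>k\<close>, then they are determined by \<open>k\<close> of their coordinates, and there
  are at most \<open>n + k choose k\<close> of them. Otherwise the \<open>m\<close>-fold sums of \<open>k + 2\<close> affinely independent
  leads show that \<open>\<phi> (n * m)\<close> grows at least like \<open>m\<close> to the power \<open>k + 1\<close>.\<close>

subsection \<open>Linear algebra\<close>

text \<open>Gaussian elimination, one equation at a time: an equation with a nonzero coefficient is
  solved for one unknown, which is substituted into the others; an equation whose coefficients all
  vanish is dropped.\<close>

lemma homogeneous_system_nontrivial_solution:
  fixes a :: "'s \<Rightarrow> 't \<Rightarrow> real"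
  assumes "finite S" "finite T" "card S < card T"
  shows "\<exists>x. (\<exists>t\<in>T. x t \<noteq> 0) \<and> (\<forall>s\<in>S. (\<Sum>t\<in>T. a s t * x t) = 0)"
  using assms
proof (induction S arbitrary: T a rule: finite_induct)
  case empty
  then have "T \<noteq> {}" by auto
  then show ?case by (intro exI[of _ "\<lambda>_. 1"]) auto
next
  case (insert s S)
  show ?case
  proof (cases "\<forall>t\<in>T. a s t = 0")
    case True
    from insert have "card S < card T" by simp
    from insert.IH[OF insert.prems(1) this, of a] True show ?thesis by auto
  next
    case False
    then obtain t0 where t0: "t0 \<in> T" "a s t0 \<noteq> 0" by blast
    let ?T = "T - {t0}"
    let ?a = "\<lambda>s' t. a s' t - a s' t0 * a s t / a s t0"
    have "card S < card ?T" using insert t0 by auto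
    from insert.IH[OF _ this, of ?a] insert.prems obtain x t1 where
      x: "t1 \<in> ?T" "x t1 \<noteq> 0" "\<And>s'. s' \<in> S \<Longrightarrow> (\<Sum>t\<in>?T. ?a s' t * x t) = 0" by auto
    \<comment> \<open>The value that the eliminated equation forces on the unknown
      \<open>t0\<close>.\<close>
    define \<beta> where "\<beta> = - (\<Sum>t\<in>?T. a s t * x t) / a s t0"
    define y where "y = x(t0 := \<beta>)"
    have split: "(\<Sum>t\<in>T. a r t * y t) = a r t0 * \<beta> + (\<Sum>t\<in>?T. a r t * x t)" for r
    proof -
      have "(\<Sum>t\<in>T. a r t * y t) = a r t0 * y t0 + (\<Sum>t\<in>?T. a r t * y t)"
        using t0 insert.prems by (simp add: sum.remove)
      also have "(\<Sum>t\<in>?T. a r t * y t) = (\<Sum>t\<in>?T. a r t * x t)"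
        by (rule sum.cong) (auto simp: y_def)
      finally show ?thesis by (simp add: y_def)
    qed
    have "(\<Sum>t\<in>T. a s t * y t) = 0"
      unfolding split \<beta>_def using t0 by simp
    moreover have "(\<Sum>t\<in>T. a r t * y t) = 0" if "r \<in> S" for r
    proof -
      have "0 = (\<Sum>t\<in>?T. a r t * x t) - a r t0 / a s t0 * (\<Sum>t\<in>?T. a s t * x t)"
        unfolding sum_distrib_left sum_subtractf[symmetric] x(3)[OF that, symmetric]
        by (rule sum.cong) (auto simp: algebra_simps)
      then show ?thesis unfolding split \<beta>_def by simp
    qed
    ultimately show ?thesis using x by (intro exI[of _ y]) (auto simp: y_def)
  qed
qed

definition affinely_independent_on :: "'i set \<Rightarrow> ('i \<Rightarrow> nat) set \<Rightarrow> bool" where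
  "affinely_independent_on K T \<longleftrightarrow>
     (\<forall>c :: ('i \<Rightarrow> nat) \<Rightarrow> real. (\<Sum>t\<in>T. c t) = 0 \<longrightarrow>
        (\<forall>i\<in>K. (\<Sum>t\<in>T. c t * real (t i)) = 0) \<longrightarrow> (\<forall>t\<in>T. c t = 0))"

text \<open>The restrictions to \<open>K\<close> of the vectors in \<open>T\<close> form an affine
  basis of the real space over \<open>K\<close>, so the common restriction of \<open>u\<close> and
  \<open>v\<close> is an affine combination of them. Read at coordinate \<open>j\<close>, this
  combination has one value \<open>w\<close>, and \<open>u j\<close> and \<open>v j\<close> cannot
  both equal it. The vector that misses \<open>w\<close> is the new one.\<close>

lemma affinely_independent_extend:
  assumes fin: "finite T" "finite K" and card: "card T = Suc (card K)"
    and ind: "affinely_independent_on K T"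
    and agree: "\<And>i. i \<in> K \<Longrightarrow> u i = v i" and diff: "u j \<noteq> v j"
  shows "\<exists>t\<in>{u, v}. t \<notin> T \<and> affinely_independent_on (insert j K) (insert t T)"
proof -
  \<comment> \<open>The unknown \<open>None\<close> is the coefficient of \<open>u\<close>, the
    unknown \<open>Some t\<close> that of \<open>t\<close>. The equation \<open>None\<close> says
    that the coefficients sum to zero, the equation \<open>Some i\<close> compares coordinate
    \<open>i\<close>.\<close>
  let ?T = "insert None (Some ` T)" and ?K = "insert None (Some ` K)"
  let ?a = "\<lambda>i t. case i of None \<Rightarrow> 1 | Some i' \<Rightarrow> (case t of None \<Rightarrow> real (u i') | Some t' \<Rightarrow> real (t' i'))"
  have "card ?K < card ?T" using fin card by (simp add: card_image)
  then obtain x where x: "\<exists>t\<in>?T. x t \<noteq> 0" "\<forall>i\<in>?K. (\<Sum>t\<in>?T. ?a i t * x t) = 0"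
    using homogeneous_system_nontrivial_solution[of ?K ?T ?a] fin by auto
  have sum0: "x None + (\<Sum>t\<in>T. x (Some t)) = 0"
    using x(2) fin by (simp add: sum.reindex)
  have sumK: "real (u i) * x None + (\<Sum>t\<in>T. x (Some t) * real (t i)) = 0" if "i \<in> K" for i
    using bspec[OF x(2), of "Some i"] fin that by (simp add: sum.reindex mult.commute)
  have nz: "x None \<noteq> 0"
  proof
    assume 0: "x None = 0"
    have "\<forall>t\<in>T. x (Some t) = 0"
      using ind[unfolded affinely_independent_on_def, rule_format, of "\<lambda>t. x (Some t)"] sum0 sumK 0
      by simp
    with x(1) 0 show False by auto
  qed
  define a where "a t = - x (Some t) / x None" for t
  have a1: "(\<Sum>t\<in>T. a t) = 1"
    using sum0 nz by (simp add: a_def sum_divide_distrib[symmetric] sum_negf field_simps)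
  have aK: "(\<Sum>t\<in>T. a t * real (t i)) = real (u i)" if "i \<in> K" for i
  proof -
    have "(\<Sum>t\<in>T. a t * real (t i)) = - (\<Sum>t\<in>T. x (Some t) * real (t i)) / x None"
      by (simp add: a_def sum_divide_distrib sum_negf[symmetric])
    also have "- (\<Sum>t\<in>T. x (Some t) * real (t i)) = real (u i) * x None"
      using sumK[OF that] by linarith
    finally show ?thesis using nz by simp
  qed
  define w where "w = (\<Sum>t\<in>T. a t * real (t j))"
  from diff obtain t where t: "t \<in> {u, v}" "real (t j) \<noteq> w" by (metis insertCI of_nat_eq_iff)
  have tK: "t i = u i" if "i \<in> K" for i using t agree that by auto
  have "t \<notin> T"
  proof
    assume tT: "t \<in> T"
    \<comment> \<open>If \<open>t\<close> were in \<open>T\<close>, then by uniqueness of affine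
      coordinates \<open>a\<close> would be the indicator of \<open>t\<close>, and
      \<open>t j\<close> would equal \<open>w\<close>.\<close>
    let ?c = "\<lambda>r. a r - (if r = t then 1 else 0)"
    have exp: "(\<Sum>r\<in>T. ?c r * g r) = (\<Sum>r\<in>T. a r * g r) - g t" for g
    proof -
      have "(\<Sum>r\<in>T. ?c r * g r) = (\<Sum>r\<in>T. a r * g r) - (\<Sum>r\<in>T. if r = t then g r else 0)"
        unfolding sum_subtractf[symmetric] by (rule sum.cong) (auto simp: algebra_simps)
      then show ?thesis using tT fin by simp
    qed
    have "\<forall>r\<in>T. ?c r = 0"
      using ind[unfolded affinely_independent_on_def, rule_format, of ?c] exp[of "\<lambda>_. 1"] a1
        exp[of "\<lambda>r. real (r _)"] aK tK by simp
    then have "0 = (\<Sum>r\<in>T. ?c r * real (r j))" by (simp add: sum.neutral)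
    then show False using exp[of "\<lambda>r. real (r j)"] t(2) by (simp add: w_def)
  qed
  moreover have "affinely_independent_on (insert j K) (insert t T)"
    unfolding affinely_independent_on_def
  proof (intro allI impI)
    fix c :: "('a \<Rightarrow> nat) \<Rightarrow> real"
    assume c0: "(\<Sum>r\<in>insert t T. c r) = 0"
      and cK: "\<forall>i\<in>insert j K. (\<Sum>r\<in>insert t T. c r * real (r i)) = 0"
    \<comment> \<open>On \<open>K\<close> the vector \<open>t\<close> is the combination
      \<open>a\<close> of \<open>T\<close>; substituting it turns the relation \<open>c\<close> into
      one among the vectors of \<open>T\<close> alone. Coordinate \<open>j\<close> then leaves
      \<open>c t * (w - t j) = 0\<close>.\<close>
    let ?d = "\<lambda>r. c r + c t * a r"
    have exp: "(\<Sum>r\<in>T. ?d r * g r) = (\<Sum>r\<in>T. c r * g r) + c t * (\<Sum>r\<in>T. a r * g r)" for g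
      by (simp add: sum_distrib_left sum.distrib[symmetric] algebra_simps)
    have d0: "\<forall>r\<in>T. ?d r = 0"
    proof (rule ind[unfolded affinely_independent_on_def, rule_format, of ?d, THEN ballI])
      show "(\<Sum>r\<in>T. ?d r) = 0"
        using exp[of "\<lambda>_. 1"] a1 c0 fin \<open>t \<notin> T\<close> by simp
      show "(\<Sum>r\<in>T. ?d r * real (r i)) = 0" if "i \<in> K" for i
        using exp[of "\<lambda>r. real (r i)"] aK[OF that] bspec[OF cK, of i] that fin \<open>t \<notin> T\<close> tK[OF that]
        by simp
    qed
    then have "0 = (\<Sum>r\<in>T. ?d r * real (r j))" by (simp add: sum.neutral)
    also have "\<dots> = (\<Sum>r\<in>T. c r * real (r j)) + c t * w"
      using exp[of "\<lambda>r. real (r j)"] by (simp add: w_def)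
    also have "\<dots> = c t * (w - real (t j))"
      using cK fin \<open>t \<notin> T\<close> by (simp add: algebra_simps)
    finally have "c t = 0" using t(2) by simp
    with d0 show "\<forall>r\<in>insert t T. c r = 0" by simp
  qed
  ultimately show ?thesis using t(1) by blast
qed

text \<open>Grow \<open>K\<close> and \<open>T\<close> together: as long as the coordinates in
  \<open>K\<close> fail to separate two vectors of \<open>S\<close>, a coordinate \<open>j\<close>
  where these two differ joins \<open>K\<close> and one of the two joins \<open>T\<close>.\<close>

lemma coordinates_or_affinely_independent:
  fixes S :: "('i \<Rightarrow> nat) set"
  assumes "finite I" and supp: "\<And>t i. t \<in> S \<Longrightarrow> i \<notin> I \<Longrightarrow> t i = 0" and "S \<noteq> {}"
  shows "(\<exists>K\<subseteq>I. card K < k \<and> inj_on (\<lambda>t. restrict t K) S) \<or>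
         (\<exists>K\<subseteq>I. \<exists>T\<subseteq>S. finite T \<and> card K = k \<and> card T = Suc k \<and> affinely_independent_on K T)"
proof (induction k)
  case 0
  from \<open>S \<noteq> {}\<close> obtain t where "t \<in> S" by blast
  then show ?case
    by (intro disjI2 exI[of _ "{}"] conjI exI[of _ "{t}"]) (auto simp: affinely_independent_on_def)
next
  case (Suc k)
  from Suc consider "\<exists>K\<subseteq>I. card K < k \<and> inj_on (\<lambda>t. restrict t K) S"
    | K T where "K \<subseteq> I" "T \<subseteq> S" "finite T" "card K = k" "card T = Suc k" "affinely_independent_on K T"
    by blast
  then show ?case
  proof cases
    case 1
    then show ?thesis using less_SucI by blast
  next
    case 2
    show ?thesis
    proof (cases "inj_on (\<lambda>t. restrict t K) S")
      case True
      with 2 show ?thesis by (metis lessI)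
    next
      case False
      then obtain u v where uv: "u \<in> S" "v \<in> S" "u \<noteq> v" "restrict u K = restrict v K"
        by (auto simp: inj_on_def)
      then obtain j where j: "u j \<noteq> v j" by blast
      have agree: "u i = v i" if "i \<in> K" for i using uv(4) that by (metis restrict_apply)
      have "j \<in> I" using j supp uv by metis
      have "j \<notin> K" using j agree by blast
      have "finite K" using 2 \<open>finite I\<close> finite_subset by blast
      from affinely_independent_extend[of T K u v j] this 2 agree j obtain t where
        "t \<in> {u, v}" "t \<notin> T" "affinely_independent_on (insert j K) (insert t T)" by auto
      then show ?thesis using 2 uv \<open>j \<in> I\<close> \<open>j \<notin> K\<close> \<open>finite K\<close>
        by (intro disjI2 exI[of _ "insert j K"] conjI exI[of _ "insert t T"]) auto
    qed
  qed
qed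

lemma card_le_choose_if_coordinates:
  fixes S :: "('i \<Rightarrow> nat) set"
  assumes "finite K" "card K \<le> k" and inj: "inj_on (\<lambda>t. restrict t K) S"
    and sum: "\<And>t. t \<in> S \<Longrightarrow> sum t K \<le> n"
  shows "card S \<le> (n + k) choose k"
proof -
  obtain ks where ks: "set ks = K" "distinct ks" using \<open>finite K\<close> finite_distinct_list by blast
  then have len: "length ks \<le> k" using assms(2) by (metis distinct_card)
  let ?L = "{l :: nat list. size l = Suc k \<and> sum_list l = n}"
  \<comment> \<open>Stars and bars: zeros pad the vector to length \<open>k\<close>, and the last
    entry is the slack that brings the sum to exactly \<open>n\<close>.\<close>
  define g where "g t = map t ks @ replicate (k - length ks) 0 @ [n - sum t K]" for t :: "'i \<Rightarrow> nat"
  have "g t \<in> ?L" if "t \<in> S" for t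
  proof -
    have "sum_list (map t ks) = sum t K" using ks by (simp add: sum_list_distinct_conv_sum_set)
    then show ?thesis using sum[OF that] len by (simp add: g_def sum_list_replicate)
  qed
  moreover have "inj_on g S"
  proof (rule inj_onI)
    fix t u assume tu: "t \<in> S" "u \<in> S" "g t = g u"
    then have "map t ks = map u ks" by (simp add: g_def)
    then have "restrict t K = restrict u K" using ks by (auto simp: restrict_def)
    with inj tu show "t = u" by (auto dest: inj_onD)
  qed
  moreover have "finite ?L"
    by (rule finite_subset[OF _ finite_lists_length_eq[of "{..n}" "Suc k"]])
      (auto intro: member_le_sum_list)
  ultimately have "card S \<le> card ?L" by (intro card_inj_on_le) auto
  also have "card ?L = (n + k) choose n" by (simp add: card_length_sum_list)
  finally show ?thesis by (metis add_diff_cancel_left' binomial_symmetric le_add1)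
qed

subsection \<open>Homogeneous sequences of blocks\<close>

lemma sorted_list_of_set_strict_mono_image:
  fixes g :: "'b::linorder \<Rightarrow> 'c::linorder"
  assumes "finite X" "strict_mono_on X g"
  shows "sorted_list_of_set (g ` X) = map g (sorted_list_of_set X)"
proof -
  have "sorted_wrt (<) (map g (sorted_list_of_set X))"
    unfolding sorted_wrt_map
  proof (rule sorted_wrt_mono_rel[OF _ strict_sorted_list_of_set[of X]])
    fix x y assume "x \<in> set (sorted_list_of_set X)" "y \<in> set (sorted_list_of_set X)" "x < y"
    with assms show "g x < g y" by (simp add: strict_mono_on_def)
  qed
  moreover have "set (map g (sorted_list_of_set X)) = g ` X" using assms by simp
  ultimately show ?thesis
    by (intro strict_sorted_equal) (use assms in auto)
qed

text \<open>Ramsey's theorem is applied for one size after the other, each time inside the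
  homogeneous set already found; passing to a subset keeps the earlier sizes homogeneous.\<close>

lemma simultaneous_Ramsey:
  fixes col :: "nat \<Rightarrow> nat set \<Rightarrow> 'c"
  assumes fin: "\<And>l. finite (col l ` {X. finite X \<and> card X = l})"
  shows "\<exists>Y. infinite Y \<and> (\<forall>l<D. \<forall>X X'. X \<subseteq> Y \<and> finite X \<and> card X = l \<and>
           X' \<subseteq> Y \<and> finite X' \<and> card X' = l \<longrightarrow> col l X = col l X')"
proof (induction D)
  case 0
  show ?case by (intro exI[of _ UNIV]) auto
next
  case (Suc D)
  then obtain Y where Y: "infinite Y" and hom: "\<And>l X X'. l < D \<Longrightarrow> X \<subseteq> Y \<Longrightarrow> finite X \<Longrightarrow>
      card X = l \<Longrightarrow> X' \<subseteq> Y \<Longrightarrow> finite X' \<Longrightarrow> card X' = l \<Longrightarrow> col l X = col l X'" by metis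
  \<comment> \<open>Ramsey's theorem expects colours that are naturals below a bound, so the
    finitely many colours are numbered by \<open>e\<close>.\<close>
  from finite_imp_inj_to_nat_seg[OF fin[of D]] obtain e :: "'c \<Rightarrow> nat" and s where
    e: "e ` (col D ` {X. finite X \<and> card X = D}) = {i. i < s}"
       "inj_on e (col D ` {X. finite X \<and> card X = D})" by blast
  have "\<forall>X. X \<subseteq> Y \<and> finite X \<and> card X = D \<longrightarrow> e (col D X) < s" using e(1) by blast
  from Ramsey[OF Y this] obtain Y' t where Y': "Y' \<subseteq> Y" "infinite Y'"
    and t: "\<And>X. X \<subseteq> Y' \<Longrightarrow> finite X \<Longrightarrow> card X = D \<Longrightarrow> e (col D X) = t" by metis
  have top: "col D X = col D X'" if "X \<subseteq> Y'" "finite X" "card X = D" "X' \<subseteq> Y'" "finite X'" "card X' = D" for X X'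
    by (rule inj_onD[OF e(2)]) (use that t in auto)
  show ?case
  proof (intro exI[of _ Y'] conjI allI impI)
    show "infinite Y'" by fact
    fix l X X' assume l: "l < Suc D"
      and X: "X \<subseteq> Y' \<and> finite X \<and> card X = l \<and> X' \<subseteq> Y' \<and> finite X' \<and> card X' = l"
    show "col l X = col l X'"
    proof (cases "l = D")
      case True
      with X top show ?thesis by simp
    next
      case False
      with l have "l < D" by simp
      then show ?thesis using hom[of l X X'] X Y'(1) by blast
    qed
  qed
qed

text \<open>The map \<open>b x\<close> sends \<open>F\<close> to the block at position
  \<open>x\<close>. A function \<open>c\<close> is read as a word with the subset \<open>c x\<close>
  of \<open>F\<close> as its letter at position \<open>x\<close>, and this is the set that the word
  spells.\<close>

definition place :: "(nat \<Rightarrow> 'a \<Rightarrow> 'a) \<Rightarrow> nat set \<Rightarrow> (nat \<Rightarrow> 'a set) \<Rightarrow> 'a set" where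
  "place b X c = (\<Union>x\<in>X. b x ` c x)"

text \<open>The product of Cameron's age algebra.\<close>

definition conv :: "('a set \<Rightarrow> real) \<Rightarrow> ('a set \<Rightarrow> real) \<Rightarrow> 'a set \<Rightarrow> real" where
  "conv f g P = (\<Sum>M\<in>Pow P. f M * g (P - M))"

text \<open>The combinatorial argument sees a relational structure only through the types of its
  finite subsets. The bijection in \<open>transfer\<close> stands for an isomorphism, which is why
  it respects the types of all subsets.\<close>

locale inexhaustible_types =
  fixes E :: "'a set" and \<tau> :: "'a set \<Rightarrow> 't"
  assumes transfer: "\<lbrakk>A \<subseteq> E; finite A; B \<subseteq> E; finite B; \<tau> A = \<tau> B\<rbrakk>
      \<Longrightarrow> \<exists>h. bij_betw h A B \<and> (\<forall>X\<subseteq>A. \<tau> (h ` X) = \<tau> X)"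
    and disjoint_copies: "\<lbrakk>A \<subseteq> E; finite A; B \<subseteq> E; finite B\<rbrakk>
      \<Longrightarrow> \<exists>A' B'. A' \<subseteq> E \<and> finite A' \<and> B' \<subseteq> E \<and> finite B' \<and> A' \<inter> B' = {} \<and> \<tau> A' = \<tau> A \<and> \<tau> B' = \<tau> B"
    and finite_types: "finite {\<tau> A |A. A \<subseteq> E \<and> finite A \<and> card A = n}"
begin

section \<open>Types and age functions\<close>

definition types :: "nat \<Rightarrow> 't set" where
  "types n = {\<tau> A |A. A \<subseteq> E \<and> finite A \<and> card A = n}"

definition age_fun :: "nat \<Rightarrow> ('a set \<Rightarrow> real) \<Rightarrow> bool" where
  "age_fun d f \<longleftrightarrow> (\<forall>P. f P \<noteq> 0 \<longrightarrow> P \<subseteq> E \<and> finite P \<and> card P = d) \<and>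
     (\<forall>P Q. P \<subseteq> E \<and> finite P \<and> Q \<subseteq> E \<and> finite Q \<and> \<tau> P = \<tau> Q \<longrightarrow> f P = f Q)"

lemma age_funD:
  assumes "age_fun d f" "f P \<noteq> 0"
  shows "P \<subseteq> E" "finite P" "card P = d"
  using assms(1)[unfolded age_fun_def, THEN conjunct1, rule_format, OF assms(2)] by simp_all

lemma age_fun_eq:
  assumes "age_fun d f" "P \<subseteq> E" "finite P" "Q \<subseteq> E" "finite Q" "\<tau> P = \<tau> Q"
  shows "f P = f Q"
  using assms(1)[unfolded age_fun_def, THEN conjunct2, rule_format, of P Q] assms(2-) by simp

lemma card_eq_if_type_eq:
  assumes "A \<subseteq> E" "finite A" "B \<subseteq> E" "finite B" "\<tau> A = \<tau> B"
  shows "card A = card B"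
  using transfer[OF assms] bij_betw_same_card by blast

lemma age_fun_one: "age_fun 0 (\<lambda>P. if P = {} then 1 else 0)"
  unfolding age_fun_def
proof (intro conjI allI impI; (elim conjE)?)
  fix P Q assume "P \<subseteq> E" "finite P" "Q \<subseteq> E" "finite Q" "\<tau> P = \<tau> Q"
  then have "card P = card Q" by (rule card_eq_if_type_eq)
  then show "(if P = {} then 1 else 0) = (if Q = {} then 1 else (0::real))"
    using \<open>finite P\<close> \<open>finite Q\<close> by (metis card_0_eq)
next
  fix P :: "'a set" assume "(if P = {} then 1 else 0 :: real) \<noteq> 0"
  then have "P = {}" by presburger
  then show "P \<subseteq> E" "finite P" "card P = 0" by simp_all
qed

lemma age_fun_sum:
  assumes "\<And>i. i \<in> I \<Longrightarrow> age_fun d (f i)"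
  shows "age_fun d (\<lambda>P. \<Sum>i\<in>I. c i * f i P)"
  unfolding age_fun_def
proof (intro conjI allI impI; (elim conjE)?)
  fix P assume "(\<Sum>i\<in>I. c i * f i P) \<noteq> 0"
  then obtain i where "i \<in> I" "c i * f i P \<noteq> 0" by (meson sum.neutral)
  then have "age_fun d (f i)" "f i P \<noteq> 0" using assms by auto
  then show "P \<subseteq> E" "finite P" "card P = d" by (rule age_funD)+
next
  fix P Q assume "P \<subseteq> E" "finite P" "Q \<subseteq> E" "finite Q" "\<tau> P = \<tau> Q"
  then show "(\<Sum>i\<in>I. c i * f i P) = (\<Sum>i\<in>I. c i * f i Q)"
    using assms by (intro sum.cong refl arg_cong2[of _ _ _ _ times] age_fun_eq) auto
qed

lemma age_fun_of_types:
  "age_fun n (\<lambda>P. if P \<subseteq> E \<and> finite P \<and> card P = n then x (\<tau> P) else 0)"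
  unfolding age_fun_def
proof (intro conjI allI impI; (elim conjE)?)
  fix P Q assume PQ: "P \<subseteq> E" "finite P" "Q \<subseteq> E" "finite Q" "\<tau> P = \<tau> Q"
  then have "card P = card Q" by (rule card_eq_if_type_eq)
  with PQ show "(if P \<subseteq> E \<and> finite P \<and> card P = n then x (\<tau> P) else 0) =
    (if Q \<subseteq> E \<and> finite Q \<and> card Q = n then x (\<tau> Q) else 0)" by simp
qed (simp_all split: if_splits)

text \<open>A type-preserving bijection from \<open>P\<close> to \<open>Q\<close> carries the
  splittings of \<open>P\<close> to those of \<open>Q\<close> and keeps the types of both parts, so
  the sums agree term by term.\<close>

lemma age_fun_conv:
  assumes f: "age_fun i f" and g: "age_fun j g"
  shows "age_fun (i + j) (conv f g)"
  unfolding age_fun_def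
proof (intro conjI allI impI; (elim conjE)?)
  fix P assume nz: "conv f g P \<noteq> 0"
  then obtain M where M: "M \<subseteq> P" "f M * g (P - M) \<noteq> 0"
    unfolding conv_def by (meson PowD sum.neutral)
  then have "M \<subseteq> E" "finite M" "card M = i" "P - M \<subseteq> E" "finite (P - M)" "card (P - M) = j"
    using age_funD[OF f] age_funD[OF g] by auto
  then show "P \<subseteq> E" "finite P" "card P = i + j"
    using M(1) card_Un_disjoint[of M "P - M"] by (auto simp: Un_absorb1)
next
  fix P Q assume P: "P \<subseteq> E" "finite P" and Q: "Q \<subseteq> E" "finite Q" and "\<tau> P = \<tau> Q"
  then obtain h where h: "bij_betw h P Q" "\<And>X. X \<subseteq> P \<Longrightarrow> \<tau> (h ` X) = \<tau> X" using transfer by meson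
  have "conv f g Q = (\<Sum>M\<in>Pow P. f (h ` M) * g (Q - h ` M))"
    unfolding conv_def by (rule sum.reindex_bij_betw[symmetric, OF bij_betw_Pow[OF h(1)]])
  also have "\<dots> = conv f g P"
    unfolding conv_def
  proof (rule sum.cong[OF refl])
    fix M assume "M \<in> Pow P"
    then have M: "M \<subseteq> P" by simp
    have diff: "Q - h ` M = h ` (P - M)"
      using h(1) M by (auto simp: bij_betw_def inj_on_def)
    have im: "h ` X \<subseteq> E" "finite (h ` X)" "X \<subseteq> E" "finite X" if "X \<subseteq> P" for X
      using that h(1) P Q by (auto simp: bij_betw_def intro: finite_subset)
    show "f (h ` M) * g (Q - h ` M) = f M * g (P - M)"
      unfolding diff
      using age_fun_eq[OF f _ _ _ _ h(2)[of M]] age_fun_eq[OF g _ _ _ _ h(2)[of "P - M"]] M im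
      by (metis Diff_subset)
  qed
  finally show "conv f g P = conv f g Q" ..
qed

section \<open>Sequences of disjoint copies and their homogeneity\<close>

lemma many_disjoint_copies:
  assumes F: "F \<subseteq> E" "finite F"
  shows "\<exists>G :: nat \<Rightarrow> 'a set. (\<forall>i<q. G i \<subseteq> E \<and> finite (G i) \<and> \<tau> (G i) = \<tau> F) \<and>
           (\<forall>i<q. \<forall>j<q. i \<noteq> j \<longrightarrow> G i \<inter> G j = {})"
proof (induction q)
  case 0
  show ?case by simp
next
  case (Suc q)
  then obtain G :: "nat \<Rightarrow> 'a set" where
    G: "\<And>i. i < q \<Longrightarrow> G i \<subseteq> E \<and> finite (G i) \<and> \<tau> (G i) = \<tau> F"
    and disj: "\<And>i j. i < q \<Longrightarrow> j < q \<Longrightarrow> i \<noteq> j \<Longrightarrow> G i \<inter> G j = {}" by metis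
  let ?Y = "\<Union>i<q. G i"
  have Y: "?Y \<subseteq> E" "finite ?Y" using G by auto
  \<comment> \<open>The union of the first \<open>q\<close> copies is treated as a single set. A
    copy \<open>B\<close> of it is found beside a new copy \<open>A\<close> of \<open>F\<close>, and
    \<open>h\<close> moves the old copies into \<open>B\<close>.\<close>
  from disjoint_copies[OF F Y] obtain A B where
    A: "A \<subseteq> E" "finite A" "\<tau> A = \<tau> F" and B: "B \<subseteq> E" "finite B" "\<tau> ?Y = \<tau> B" and AB: "A \<inter> B = {}"
    by metis
  from transfer[OF Y B] obtain h where h: "bij_betw h ?Y B" "\<And>X. X \<subseteq> ?Y \<Longrightarrow> \<tau> (h ` X) = \<tau> X" by meson
  have hG: "h ` G i \<subseteq> B" "\<tau> (h ` G i) = \<tau> F" if "i < q" for i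
  proof -
    from that have sub: "G i \<subseteq> ?Y" by blast
    then show "h ` G i \<subseteq> B" using h(1) by (auto simp: bij_betw_def)
    show "\<tau> (h ` G i) = \<tau> F" using h(2)[OF sub] G[OF that] by simp
  qed
  have hdisj: "h ` G i \<inter> h ` G j = {}" if "i < q" "j < q" "i \<noteq> j" for i j
  proof -
    have "h ` G i \<inter> h ` G j = h ` (G i \<inter> G j)"
      using that h(1) by (intro inj_on_image_Int[of h ?Y, symmetric]) (auto simp: bij_betw_def)
    then show ?thesis using disj[OF that] by simp
  qed
  show ?case
  proof (intro exI[of _ "\<lambda>i. if i < q then h ` G i else A"] conjI allI impI)
    fix i assume "i < Suc q"
    show "(if i < q then h ` G i else A) \<subseteq> E" "finite (if i < q then h ` G i else A)"
      "\<tau> (if i < q then h ` G i else A) = \<tau> F"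
      using A B G hG(1)[of i] hG(2)[of i] by auto
    fix j assume "j < Suc q" "i \<noteq> j"
    with \<open>i < Suc q\<close> show "(if i < q then h ` G i else A) \<inter> (if j < q then h ` G j else A) = {}"
      using hdisj[of i j] hG(1)[of i] hG(1)[of j] AB by (cases "i < q"; cases "j < q"; simp; blast)
  qed
qed

text \<open>Among \<open>card X + 1\<close> pairwise disjoint copies, one misses \<open>X\<close> by
  the pigeonhole principle.\<close>

lemma copy_avoiding:
  assumes F: "F \<subseteq> E" "finite F" and X: "finite X"
  shows "\<exists>A\<subseteq>E. finite A \<and> \<tau> A = \<tau> F \<and> A \<inter> X = {}"
proof (rule ccontr)
  assume no: "\<not> ?thesis"
  from many_disjoint_copies[OF F, of "Suc (card X)"] obtain G :: "nat \<Rightarrow> 'a set" where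
    G: "\<And>i. i < Suc (card X) \<Longrightarrow> G i \<subseteq> E \<and> finite (G i) \<and> \<tau> (G i) = \<tau> F"
    and disj: "\<And>i j. i < Suc (card X) \<Longrightarrow> j < Suc (card X) \<Longrightarrow> i \<noteq> j \<Longrightarrow> G i \<inter> G j = {}" by metis
  have "\<forall>i\<in>{..<Suc (card X)}. \<exists>x. x \<in> G i \<inter> X" using no G by blast
  then obtain p where p: "\<And>i. i < Suc (card X) \<Longrightarrow> p i \<in> G i \<inter> X" by (metis lessThan_iff)
  have "inj_on p {..<Suc (card X)}"
  proof (rule inj_onI, rule ccontr)
    fix i j assume "i \<in> {..<Suc (card X)}" "j \<in> {..<Suc (card X)}" "p i = p j" "i \<noteq> j"
    then show False using p[of i] p[of j] disj[of i j] by auto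
  qed
  then have "card {..<Suc (card X)} \<le> card X"
    using p X by (intro card_inj_on_le[of p]) auto
  then show False by simp
qed

lemma disjoint_block_sequence:
  assumes F: "F \<subseteq> E" "finite F"
  shows "\<exists>b :: nat \<Rightarrow> 'a \<Rightarrow> 'a. (\<forall>x. inj_on (b x) F \<and> b x ` F \<subseteq> E \<and> (\<forall>M\<subseteq>F. \<tau> (b x ` M) = \<tau> M)) \<and>
           (\<forall>x y. x \<noteq> y \<longrightarrow> b x ` F \<inter> b y ` F = {})"
proof -
  obtain G where G: "\<And>X. finite X \<Longrightarrow> G X \<subseteq> E \<and> finite (G X) \<and> \<tau> F = \<tau> (G X) \<and> G X \<inter> X = {}"
    using copy_avoiding[OF F] by metis
  \<comment> \<open>\<open>acc x\<close> collects the blocks chosen before step \<open>x\<close>;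
    block \<open>x\<close> is a copy of \<open>F\<close> outside it.\<close>
  define acc where "acc = rec_nat {} (\<lambda>_ Y. Y \<union> G Y)"
  have acc_Suc: "acc (Suc n) = acc n \<union> G (acc n)" for n by (simp add: acc_def)
  have fin: "finite (acc n)" for n
    by (induction n) (use G acc_Suc in \<open>auto simp: acc_def\<close>)
  have mono: "acc m \<subseteq> acc n" if "m \<le> n" for m n
    using that by (rule lift_Suc_mono_le[rotated]) (simp add: acc_Suc)
  have "\<exists>h. bij_betw h F (G (acc x)) \<and> (\<forall>X\<subseteq>F. \<tau> (h ` X) = \<tau> X)" for x
    using transfer[of F "G (acc x)"] F G[OF fin[of x]] by auto
  then obtain b where b: "\<And>x. bij_betw (b x) F (G (acc x)) \<and> (\<forall>X\<subseteq>F. \<tau> (b x ` X) = \<tau> X)" by metis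
  have disj: "b x ` F \<inter> b y ` F = {}" if "x < y" for x y
  proof -
    have "b x ` F \<subseteq> acc y"
      using b[of x] mono[of "Suc x" y] that acc_Suc[of x] by (auto simp: bij_betw_def)
    then show ?thesis using b[of y] G[OF fin[of y]] by (auto simp: bij_betw_def)
  qed
  show ?thesis
  proof (intro exI[of _ b] conjI allI impI)
    fix x y :: nat assume "x \<noteq> y"
    then show "b x ` F \<inter> b y ` F = {}" using disj[of x y] disj[of y x] by (cases "x < y") auto
  next
    fix x
    show "inj_on (b x) F" "b x ` F \<subseteq> E" using b[of x] G[OF fin[of x]] by (auto simp: bij_betw_def)
    show "\<tau> (b x ` M) = \<tau> M" if "M \<subseteq> F" for M using b[of x] that by blast
  qed
qed

text \<open>An \<open>l\<close>-element set of positions is coloured by the function that maps each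
  word of \<open>l\<close> subsets of \<open>F\<close> to the type of the set spelled at these
  positions. Ramsey's theorem makes this colour depend on \<open>l\<close> only, for all
  \<open>l\<close> up to \<open>D\<close>.\<close>

lemma homogeneous_block_sequence:
  assumes F: "F \<subseteq> E" "finite F"
  shows "\<exists>b :: nat \<Rightarrow> 'a \<Rightarrow> 'a. (\<forall>x. inj_on (b x) F \<and> b x ` F \<subseteq> E \<and> (\<forall>M\<subseteq>F. \<tau> (b x ` M) = \<tau> M)) \<and>
           (\<forall>x y. x \<noteq> y \<longrightarrow> b x ` F \<inter> b y ` F = {}) \<and>
           (\<forall>X h c. finite X \<and> card X \<le> D \<and> strict_mono_on X h \<and> (\<forall>x\<in>X. c (h x) \<subseteq> F) \<longrightarrow>
              \<tau> (place b X (c \<circ> h)) = \<tau> (place b (h ` X) c))"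
proof -
  obtain b :: "nat \<Rightarrow> 'a \<Rightarrow> 'a" where
    b: "\<And>x. inj_on (b x) F \<and> b x ` F \<subseteq> E \<and> (\<forall>M\<subseteq>F. \<tau> (b x ` M) = \<tau> M)"
    and disj: "\<And>x y. x \<noteq> y \<Longrightarrow> b x ` F \<inter> b y ` F = {}"
    using disjoint_block_sequence[OF F] by metis
  let ?W = "\<lambda>l. {..<l::nat} \<rightarrow>\<^sub>E Pow F"
  define col where "col l X = (\<lambda>w\<in>?W l. \<tau> (\<Union>j<l. b (sorted_list_of_set X ! j) ` w j))" for l X
  have "finite (col l ` {X. finite X \<and> card X = l})" for l
  proof (rule finite_subset)
    \<comment> \<open>There are finitely many colours: there are finitely many words, and each
      spells a set of at most \<open>l * card F\<close> points, for which finitely many types are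
      possible.\<close>
    show "col l ` {X. finite X \<and> card X = l} \<subseteq> ?W l \<rightarrow>\<^sub>E (\<Union>m\<le>l * card F. types m)"
    proof (clarify, rule PiE_I)
      fix X :: "nat set" and w assume w: "w \<in> ?W (card X)"
      let ?l = "card X"
      let ?P = "\<Union>j<?l. b (sorted_list_of_set X ! j) ` w j"
      have wF: "w j \<subseteq> F" if "j < ?l" for j using w that by auto
      have "?P \<subseteq> E" using wF b by blast
      moreover have "finite ?P" using wF F(2) by (auto intro: finite_subset)
      moreover have "card ?P \<le> ?l * card F"
      proof -
        have "card ?P \<le> (\<Sum>j<?l. card (b (sorted_list_of_set X ! j) ` w j))" by (rule card_UN_le) simp
        also have "\<dots> \<le> (\<Sum>j<?l. card F)"
          using wF F(2) by (intro sum_mono) (meson card_image_le card_mono finite_subset lessThan_iff order_trans)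
        finally show ?thesis by simp
      qed
      ultimately have "card ?P \<in> {..?l * card F}" "\<tau> ?P \<in> types (card ?P)"
        unfolding types_def by auto
      then have "\<tau> ?P \<in> (\<Union>m\<le>?l * card F. types m)" by (rule UN_I)
      then show "col (card X) X w \<in> (\<Union>m\<le>card X * card F. types m)"
        using w by (simp add: col_def)
    next
      fix X :: "nat set" and w assume "w \<notin> ?W (card X)"
      then show "col (card X) X w = undefined" unfolding col_def by (simp only: restrict_apply if_False)
    qed
    show "finite (?W l \<rightarrow>\<^sub>E (\<Union>m\<le>l * card F. types m))"
      using F finite_types by (intro finite_PiE finite_UN_I) (simp_all add: types_def)
  qed
  from simultaneous_Ramsey[of col "Suc D", OF this] obtain Y where Y: "infinite Y" and
    hom0: "\<forall>l<Suc D. \<forall>X X'. X \<subseteq> Y \<and> finite X \<and> card X = l \<and>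
           X' \<subseteq> Y \<and> finite X' \<and> card X' = l \<longrightarrow> col l X = col l X'" by (elim exE conjE)
  have hom: "col l X = col l X'" if "l \<le> D" "X \<subseteq> Y" "finite X" "card X = l" "X' \<subseteq> Y" "finite X'" "card X' = l"
    for l X X' by (rule hom0[rule_format, of l]) (use that in auto)
  \<comment> \<open>Only the blocks with index in \<open>Y\<close> are kept, renumbered in
    increasing order.\<close>
  define e where "e = enumerate Y"
  have e: "strict_mono e" "\<And>x. e x \<in> Y"
    unfolding e_def using Y by (auto simp: strict_mono_enumerate enumerate_in_set)
  show ?thesis
  proof (intro exI[of _ "\<lambda>x. b (e x)"] conjI allI impI; (elim conjE)?)
    fix x y :: nat assume "x \<noteq> y"
    then show "b (e x) ` F \<inter> b (e y) ` F = {}" using disj e(1) by (simp add: strict_mono_eq)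
  next
    fix X :: "nat set" and h :: "nat \<Rightarrow> nat" and c :: "nat \<Rightarrow> 'a set"
    assume X: "finite X" "card X \<le> D" and h: "strict_mono_on X h" and c: "\<forall>x\<in>X. c (h x) \<subseteq> F"
    define xs where "xs = sorted_list_of_set X"
    have len: "length xs = card X" and set: "set xs = X" using X by (auto simp: xs_def)
    define w where "w = (\<lambda>j\<in>{..<card X}. c (h (xs ! j)))"
    have setX: "(!) xs ` {..<card X} = X" using set len[symmetric] by (auto simp: set_conv_nth)
    have nthX: "xs ! j \<in> X" if "j < card X" for j using that len set nth_mem by metis
    have w: "w \<in> ?W (card X)" using c nthX by (auto simp: w_def)
    have key: "col (card X) (g ` X) w = \<tau> (\<Union>x\<in>X. b (g x) ` c (h x))"
      if g: "strict_mono_on X g" for g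
    proof -
      have "(\<Union>j<card X. b (sorted_list_of_set (g ` X) ! j) ` w j)
          = (\<Union>j<card X. b (g (xs ! j)) ` c (h (xs ! j)))"
        unfolding sorted_list_of_set_strict_mono_image[OF X(1) g] xs_def[symmetric]
        by (rule SUP_cong) (auto simp: w_def len)
      also have "\<dots> = (\<Union>x\<in>X. b (g x) ` c (h x))"
        by (subst (2) setX[symmetric]) simp
      finally show ?thesis using w unfolding col_def by (simp only: restrict_apply if_True)
    qed
    have g1: "strict_mono_on X e" using e(1) by (simp add: strict_mono_on_def strict_mono_def)
    have g2: "strict_mono_on X (\<lambda>x. e (h x))"
      using e(1) h by (simp add: strict_mono_on_def strict_mono_def)
    \<comment> \<open>Both position sets lie in \<open>Y\<close> and have \<open>card X\<close>
      elements, so their colours agree. Evaluating the colours at the word \<open>w\<close> gives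
      the two types to be compared.\<close>
    have "col (card X) (e ` X) = col (card X) ((\<lambda>x. e (h x)) ` X)"
      using X e(2) strict_mono_on_imp_inj_on[OF g1] strict_mono_on_imp_inj_on[OF g2]
      by (intro hom) (auto simp: card_image)
    then show "\<tau> (place (\<lambda>x. b (e x)) X (c \<circ> h)) = \<tau> (place (\<lambda>x. b (e x)) (h ` X) c)"
      using key[OF g1] key[OF g2] by (simp add: place_def)
  next
    fix x
    show "inj_on (b (e x)) F" "b (e x) ` F \<subseteq> E" using b[of "e x"] by blast+
    show "\<tau> (b (e x) ` M) = \<tau> M" if "M \<subseteq> F" for M using b[of "e x"] that by blast
  qed
qed

end

subsection \<open>Leading exponents\<close>

definition lex_less :: "nat \<Rightarrow> (nat \<Rightarrow> nat) \<Rightarrow> (nat \<Rightarrow> nat) \<Rightarrow> bool" where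
  "lex_less s a b \<longleftrightarrow> (\<exists>i<s. a i < b i \<and> (\<forall>j<i. a j = b j))"

lemma lex_less_asym: "lex_less s a b \<Longrightarrow> \<not> lex_less s b a"
  unfolding lex_less_def by (metis less_asym linorder_neqE_nat less_irrefl)

lemma lex_less_trans:
  assumes "lex_less s a b" "lex_less s b c"
  shows "lex_less s a c"
proof -
  from assms obtain i j where i: "i < s" "a i < b i" "\<And>m. m < i \<Longrightarrow> a m = b m"
    and j: "j < s" "b j < c j" "\<And>m. m < j \<Longrightarrow> b m = c m" unfolding lex_less_def by blast
  show ?thesis unfolding lex_less_def
  proof (intro exI[of _ "min i j"] conjI allI impI)
    show "a (min i j) < c (min i j)"
      using i j by (cases i j rule: linorder_cases) (auto simp: min_def)
  qed (use i j in auto)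
qed

lemma lex_less_total:
  assumes "\<not> lex_less s a b" "\<not> lex_less s b a" "i < s"
  shows "a i = b i"
proof (rule ccontr)
  assume "a i \<noteq> b i"
  define m where "m = (LEAST m. a m \<noteq> b m)"
  have m: "a m \<noteq> b m" unfolding m_def using \<open>a i \<noteq> b i\<close> by (rule LeastI)
  have "m \<le> i" unfolding m_def using \<open>a i \<noteq> b i\<close> by (rule Least_le)
  moreover have "a j = b j" if "j < m" for j using that not_less_Least unfolding m_def by blast
  ultimately show False using m assms unfolding lex_less_def
    by (metis le_less_trans linorder_neqE_nat)
qed

text \<open>At the first index where either pair differs, neither primed entry is larger and one is
  smaller, so the sum drops there. As for leading monomials, this makes leads additive.\<close>

lemma lex_less_add:
  assumes "\<not> lex_less s a a'" "\<not> lex_less s b b'"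
  shows "(\<forall>i<s. a' i = a i \<and> b' i = b i) \<or> lex_less s (\<lambda>i. a' i + b' i) (\<lambda>i. a i + b i)"
proof (cases "\<forall>i<s. a' i = a i \<and> b' i = b i")
  case False
  then obtain i where i: "i < s" "a' i \<noteq> a i \<or> b' i \<noteq> b i" by blast
  define m where "m = (LEAST m. a' m \<noteq> a m \<or> b' m \<noteq> b m)"
  have m: "a' m \<noteq> a m \<or> b' m \<noteq> b m" unfolding m_def using i(2) by (rule LeastI)
  have "m \<le> i" unfolding m_def using i(2) by (rule Least_le)
  with i have "m < s" by simp
  have below: "a' j = a j \<and> b' j = b j" if "j < m" for j
    using that not_less_Least unfolding m_def by blast
  have "a' m \<le> a m" "b' m \<le> b m"
    using assms \<open>m < s\<close> below unfolding lex_less_def by (metis not_le)+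
  with m have "a' m + b' m < a m + b m" by linarith
  then show ?thesis using \<open>m < s\<close> below unfolding lex_less_def by auto
qed simp

lemma block_index_div: "j < Suc D \<Longrightarrow> (i * Suc D + j) div Suc D = i"
  by (simp only: div_mult_self3 div_less)

locale homogeneous_blocks = inexhaustible_types E \<tau> for E :: "'a set" and \<tau> :: "'a set \<Rightarrow> 't" +
  fixes F :: "'a set" and b :: "nat \<Rightarrow> 'a \<Rightarrow> 'a" and D s :: nat and C :: "nat \<Rightarrow> 'a set"
  assumes F: "F \<subseteq> E" "finite F"
    and block_inj: "inj_on (b x) F"
    and block_sub: "b x ` F \<subseteq> E"
    and block_type: "M \<subseteq> F \<Longrightarrow> \<tau> (b x ` M) = \<tau> M"
    and block_disj: "x \<noteq> y \<Longrightarrow> b x ` F \<inter> b y ` F = {}"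
    and homogeneous: "\<lbrakk>finite X; card X \<le> D; strict_mono_on X h; \<And>x. x \<in> X \<Longrightarrow> c (h x) \<subseteq> F\<rbrakk>
      \<Longrightarrow> \<tau> (place b X (c \<circ> h)) = \<tau> (place b (h ` X) c)"
    and letters: "i < s \<Longrightarrow> C i \<subseteq> F" "i < s \<Longrightarrow> C i \<noteq> {}"
begin

lemma place_sub: "(\<And>x. x \<in> X \<Longrightarrow> c x \<subseteq> F) \<Longrightarrow> place b X c \<subseteq> E"
  using block_sub by (fastforce simp: place_def)

lemma finite_place: "finite X \<Longrightarrow> (\<And>x. x \<in> X \<Longrightarrow> c x \<subseteq> F) \<Longrightarrow> finite (place b X c)"
  using F(2) by (auto simp: place_def intro: finite_subset)

lemma place_cong: "(\<And>x. x \<in> X \<Longrightarrow> c x = c' x) \<Longrightarrow> place b X c = place b X c'"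
  by (simp add: place_def)

lemma block_eq:
  assumes "b x y = b x' y'" "y \<in> F" "y' \<in> F"
  shows "x = x'" "y = y'"
proof -
  show "x = x'" using assms block_disj[of x x'] by blast
  with assms show "y = y'" using block_inj by (auto dest: inj_onD)
qed

lemma card_le_card_place:
  assumes "finite X" "\<And>x. x \<in> X \<Longrightarrow> c x \<subseteq> F" "\<And>x. x \<in> X \<Longrightarrow> c x \<noteq> {}"
  shows "card X \<le> card (place b X c)"
proof -
  have "\<exists>y. \<forall>x\<in>X. y x \<in> c x" using assms(3) by (intro bchoice) blast
  then obtain y where y: "\<And>x. x \<in> X \<Longrightarrow> y x \<in> c x" by blast
  have "inj_on (\<lambda>x. b x (y x)) X"
    using y assms(2) block_eq(1) by (intro inj_onI) blast
  then show ?thesis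
    using y assms by (intro card_inj_on_le[OF _ _ finite_place]) (auto simp: place_def)
qed

text \<open>The block index \<open>i * Suc D + j\<close> is the \<open>j\<close>-th slot of the letter \<open>C i\<close>, so \<open>config a\<close>
  filled with \<open>letter\<close> is the word \<open>C 0 ^ a 0 \<dots> C (s - 1) ^ a (s - 1)\<close>. At most \<open>D\<close> slots of a
  letter are ever used.\<close>

definition config :: "(nat \<Rightarrow> nat) \<Rightarrow> nat set" where
  "config a = {i * Suc D + j |i j. i < s \<and> j < a i}"

definition letter :: "nat \<Rightarrow> 'a set" where
  "letter x = C (x div Suc D)"

definition weight :: "(nat \<Rightarrow> nat) \<Rightarrow> nat" where
  "weight a = (\<Sum>i<s. a i)"

text \<open>Vanishing from \<open>s\<close> on makes an exponent determined by its entries below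
  \<open>s\<close>. The bound \<open>D\<close> keeps the slots of different letters apart and the
  words short enough for \<open>homogeneous\<close>.\<close>

definition exponent :: "(nat \<Rightarrow> nat) \<Rightarrow> bool" where
  "exponent a \<longleftrightarrow> (\<forall>i\<ge>s. a i = 0) \<and> weight a \<le> D"

definition coeff :: "('a set \<Rightarrow> real) \<Rightarrow> (nat \<Rightarrow> nat) \<Rightarrow> real" where
  "coeff f a = f (place b (config a) letter)"

text \<open>The exponent vector of the word on \<open>X\<close> whose letter at position
  \<open>x\<close> is \<open>C (p x)\<close>.\<close>

definition content :: "nat set \<Rightarrow> (nat \<Rightarrow> nat) \<Rightarrow> nat \<Rightarrow> nat" where
  "content X p i = card {x \<in> X. p x = i}"

text \<open>A subset of a placed word may cut through a block, so \<open>coeff\<close> is not multiplicative. A cut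
  raises the total number of blocks used by the two parts, which is why only the words of maximal
  length enter into a lead.\<close>

definition level_le :: "nat \<Rightarrow> ('a set \<Rightarrow> real) \<Rightarrow> bool" where
  "level_le l f \<longleftrightarrow> (\<forall>X c. finite X \<and> l < card X \<and> (\<forall>x\<in>X. c x \<subseteq> F \<and> c x \<noteq> {}) \<longrightarrow> f (place b X c) = 0)"

text \<open>\<open>level_le\<close> tests words over all nonempty subsets of \<open>F\<close>, since
  the pieces of cut blocks can be arbitrary; \<open>coeff\<close> compares only the words of the
  form given by \<open>config\<close>.\<close>

definition is_lead :: "('a set \<Rightarrow> real) \<Rightarrow> (nat \<Rightarrow> nat) \<Rightarrow> bool" where
  "is_lead f a \<longleftrightarrow> exponent a \<and> level_le (weight a) f \<and> coeff f a \<noteq> 0 \<and>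
     (\<forall>a'. exponent a' \<and> weight a' = weight a \<and> lex_less s a a' \<longrightarrow> coeff f a' = 0)"

definition leads :: "nat \<Rightarrow> (nat \<Rightarrow> nat) set" where
  "leads d = {a. \<exists>f. age_fun d f \<and> is_lead f a}"

lemma exponentD:
  assumes "exponent a"
  shows "i \<ge> s \<Longrightarrow> a i = 0" "weight a \<le> D" "a i \<le> D"
proof -
  show *: "a i = 0" if "i \<ge> s" for i using assms that by (simp add: exponent_def)
  show w: "weight a \<le> D" using assms by (simp add: exponent_def)
  show "a i \<le> D"
  proof (cases "i < s")
    case True
    then have "a i \<le> weight a" unfolding weight_def by (intro member_le_sum) auto
    with w show ?thesis by simp
  qed (use * in simp)
qed

lemma exponent_eqI:
  assumes "exponent a" "exponent a'" "\<And>i. i < s \<Longrightarrow> a i = a' i"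
  shows "a = a'"
proof
  fix i show "a i = a' i"
    using assms exponentD(1)[OF assms(1)] exponentD(1)[OF assms(2)] by (cases "i < s") auto
qed

lemma finite_exponents: "finite {a. exponent a}"
proof (rule finite_subset)
  show "{a. exponent a} \<subseteq> {f. \<forall>x. (x \<in> {..<s} \<longrightarrow> f x \<in> {..D}) \<and> (x \<notin> {..<s} \<longrightarrow> f x = 0)}"
    using exponentD by auto
  show "finite {f :: nat \<Rightarrow> nat. \<forall>x. (x \<in> {..<s} \<longrightarrow> f x \<in> {..D}) \<and> (x \<notin> {..<s} \<longrightarrow> f x = 0)}"
    by (rule finite_set_of_finite_funs) auto
qed

lemma config_eq_UN: "config a = (\<Union>i<s. (\<lambda>j. i * Suc D + j) ` {..<a i})"
  by (auto simp: config_def)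

lemma finite_config [simp]: "finite (config a)"
  unfolding config_eq_UN by auto

lemma card_config_le: "card (config a) \<le> weight a"
proof -
  have "card (config a) \<le> (\<Sum>i<s. card ((\<lambda>j. i * Suc D + j) ` {..<a i}))"
    unfolding config_eq_UN by (rule card_UN_le) simp
  also have "\<dots> = weight a" by (simp add: card_image weight_def)
  finally show ?thesis .
qed

lemma sum_content:
  assumes "finite X" "\<And>x. x \<in> X \<Longrightarrow> p x < s"
  shows "weight (content X p) = card X"
proof -
  have "card X = card (\<Union>i<s. {x \<in> X. p x = i})" using assms by (intro arg_cong[of _ _ card]) auto
  also have "\<dots> = weight (content X p)"
    unfolding weight_def content_def using assms by (intro card_UN_disjoint) auto
  finally show ?thesis ..
qed

lemma exponent_content:
  assumes "finite X" "card X \<le> D" "\<And>x. x \<in> X \<Longrightarrow> p x < s"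
  shows "exponent (content X p)"
  using sum_content[OF assms(1,3)] assms by (force simp: exponent_def content_def)

lemma config_div:
  assumes "exponent a" "x \<in> config a"
  shows "x div Suc D < s" "\<exists>j<a (x div Suc D). x = x div Suc D * Suc D + j"
proof -
  from assms obtain i j where x: "x = i * Suc D + j" "i < s" "j < a i" by (auto simp: config_def)
  have "j < Suc D" using x exponentD(3)[OF assms(1), of i] by simp
  then have "x div Suc D = i" unfolding x(1) by (rule block_index_div)
  with x show "x div Suc D < s" "\<exists>j<a (x div Suc D). x = x div Suc D * Suc D + j" by auto
qed

lemma content_config:
  assumes a: "exponent a"
  shows "content (config a) (\<lambda>x. x div Suc D) = a"
proof
  fix i
  show "content (config a) (\<lambda>x. x div Suc D) i = a i"
  proof (cases "i < s")
    case True
    have "{x \<in> config a. x div Suc D = i} = (\<lambda>j. i * Suc D + j) ` {..<a i}"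
    proof (intro equalityI subsetI)
      fix x assume "x \<in> {x \<in> config a. x div Suc D = i}"
      then show "x \<in> (\<lambda>j. i * Suc D + j) ` {..<a i}" using config_div(2)[OF a, of x] by auto
    next
      fix x assume "x \<in> (\<lambda>j. i * Suc D + j) ` {..<a i}"
      then obtain j where j: "j < a i" "x = i * Suc D + j" by auto
      moreover have "j < Suc D" using j exponentD(3)[OF a, of i] by simp
      then have "x div Suc D = i" unfolding j(2) by (rule block_index_div)
      ultimately show "x \<in> {x \<in> config a. x div Suc D = i}" using True by (auto simp: config_def)
    qed
    then show ?thesis unfolding content_def by (simp add: card_image)
  next
    case False
    then have "{x \<in> config a. x div Suc D = i} = {}" using config_div(1)[OF a] by auto
    then show ?thesis using False exponentD(1)[OF a, of i] by (simp add: content_def)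
  qed
qed

lemma card_config:
  assumes "exponent a"
  shows "card (config a) = weight a"
  using sum_content[of "config a" "\<lambda>x. x div Suc D"] content_config[OF assms] config_div(1)[OF assms] by simp

lemma letter_config:
  assumes "exponent a" "x \<in> config a"
  shows "letter x \<subseteq> F" "letter x \<noteq> {}"
  using letters config_div(1)[OF assms] by (auto simp: letter_def)

lemma coeff_nonzero_weight_le:
  assumes "age_fun d f" "coeff f a \<noteq> 0" "exponent a"
  shows "weight a \<le> d"
  using card_le_card_place[of "config a" letter] letter_config[OF assms(3)] card_config[OF assms(3)]
    age_funD(3)[OF assms(1), of "place b (config a) letter"] assms(2) by (simp add: coeff_def)

text \<open>Since \<open>p\<close> is monotone, the letters occur in the order of the sequence
  \<open>C\<close>. An increasing map moves the word to the first slots of each letter, and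
  homogeneity keeps its type.\<close>

lemma coeff_content:
  assumes f: "age_fun d f" and X: "finite X" "card X \<le> D"
    and p: "\<And>x y. x \<in> X \<Longrightarrow> y \<in> X \<Longrightarrow> x \<le> y \<Longrightarrow> p x \<le> p y" "\<And>x. x \<in> X \<Longrightarrow> p x < s"
  shows "f (place b X (\<lambda>x. C (p x))) = coeff f (content X p)"
proof -
  \<comment> \<open>The number of earlier positions with the same letter index, used as the slot
    number of \<open>x\<close>.\<close>
  define r where "r x = card {y \<in> X. y < x \<and> p y = p x}" for x
  define h where "h x = p x * Suc D + r x" for x
  have rlt: "r x < content X p (p x)" if "x \<in> X" for x
    unfolding r_def content_def using X that by (intro psubset_card_mono) auto
  have rD: "r x < Suc D" for x
    unfolding r_def using card_mono[OF X(1), of "{y \<in> X. y < x \<and> p y = p x}"] X(2) by auto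
  have hdiv: "h x div Suc D = p x" for x unfolding h_def using rD by (rule block_index_div)
  have mono: "strict_mono_on X h"
  proof (rule strict_mono_onI)
    fix x y assume xy: "x \<in> X" "y \<in> X" "x < y"
    show "h x < h y"
    proof (cases "p x = p y")
      case True
      have "r x < r y" unfolding r_def
        using X xy True by (intro psubset_card_mono) auto
      then show ?thesis by (simp add: h_def True)
    next
      case False
      with p(1)[of x y] xy have "Suc (p x) \<le> p y" by simp
      then have "Suc (p x) * Suc D \<le> p y * Suc D" by (rule mult_le_mono1)
      then show ?thesis unfolding h_def using rD[of x] by simp
    qed
  qed
  have "h ` X \<subseteq> config (content X p)" using rlt p(2) by (auto simp: h_def config_def)
  moreover have "card (config (content X p)) \<le> card (h ` X)"
    using card_config_le[of "content X p"] sum_content[of X p] X p(2)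
      strict_mono_on_imp_inj_on[OF mono] by (simp add: card_image)
  ultimately have im: "h ` X = config (content X p)" by (intro card_seteq) auto
  have "place b X (\<lambda>x. C (p x)) = place b X (letter \<circ> h)" by (simp add: letter_def hdiv comp_def)
  moreover have "\<tau> (place b X (letter \<circ> h)) = \<tau> (place b (h ` X) letter)"
    using p(2) letters by (intro homogeneous X mono) (simp add: letter_def hdiv)
  ultimately have eq: "\<tau> (place b X (\<lambda>x. C (p x))) = \<tau> (place b (config (content X p)) letter)"
    by (simp add: im)
  have sub: "letter x \<subseteq> F" if "x \<in> config (content X p)" for x
    using that exponent_content[of X p, OF X p(2)] letter_config by simp
  show ?thesis unfolding coeff_def
    by (intro age_fun_eq[OF f _ _ _ _ eq] place_sub finite_place X finite_config)
      (use p(2) letters sub in auto)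
qed

text \<open>Let \<open>X1\<close> and \<open>X2\<close> be the positions whose blocks meet
  \<open>M\<close> and its complement. They cover \<open>X\<close> and have at most \<open>p\<close>
  and \<open>q\<close> elements by the level bounds. If \<open>X\<close> has \<open>p + q\<close>
  elements, they must be disjoint, so no block is cut.\<close>

lemma conv_term_split:
  assumes lev: "level_le p f" "level_le q g"
    and X: "finite X" "\<And>x. x \<in> X \<Longrightarrow> c x \<subseteq> F" "\<And>x. x \<in> X \<Longrightarrow> c x \<noteq> {}"
    and M: "M \<subseteq> place b X c" "f M * g (place b X c - M) \<noteq> 0"
  shows "card X \<le> p + q"
    and "card X = p + q \<Longrightarrow> \<exists>J\<subseteq>X. card J = p \<and> card (X - J) = q \<and> M = place b J c \<and>
           place b X c - M = place b (X - J) c"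
proof -
  define c1 where "c1 x = {y \<in> c x. b x y \<in> M}" for x
  define c2 where "c2 x = {y \<in> c x. b x y \<notin> M}" for x
  define X1 where "X1 = {x \<in> X. c1 x \<noteq> {}}"
  define X2 where "X2 = {x \<in> X. c2 x \<noteq> {}}"
  have M1: "M = place b X1 c1" using M(1) unfolding place_def X1_def c1_def by blast
  have M2: "place b X c - M = place b X2 c2" unfolding place_def X2_def c2_def by blast
  have XX: "X1 \<union> X2 = X" using X(3) by (auto simp: X1_def X2_def c1_def c2_def)
  have fin: "finite X1" "finite X2" using X(1) XX by auto
  have "f (place b X1 c1) \<noteq> 0" "g (place b X2 c2) \<noteq> 0" using M(2) M1 M2 by auto
  moreover have "\<forall>x\<in>X1. c1 x \<subseteq> F \<and> c1 x \<noteq> {}" "\<forall>x\<in>X2. c2 x \<subseteq> F \<and> c2 x \<noteq> {}"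
    using X(2) by (auto simp: X1_def X2_def c1_def c2_def)
  ultimately have le: "card X1 \<le> p" "card X2 \<le> q"
    using lev fin unfolding level_le_def by (meson not_le)+
  have cu: "card X + card (X1 \<inter> X2) = card X1 + card X2" using card_Un_Int[OF fin] XX by simp
  with le show "card X \<le> p + q" by simp
  assume "card X = p + q"
  with cu le have eq: "card X1 = p" "card X2 = q" "card (X1 \<inter> X2) = 0" by auto
  then have dis: "X1 \<inter> X2 = {}" using fin by simp
  then have X2: "X2 = X - X1" using XX by auto
  have "M = place b X1 c"
    unfolding M1 by (rule place_cong) (use dis in \<open>auto simp: X1_def X2_def c1_def c2_def\<close>)
  moreover have "place b X c - M = place b (X - X1) c"
    unfolding M2 X2[symmetric] by (rule place_cong) (use dis in \<open>auto simp: X1_def X2_def c1_def c2_def\<close>)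
  ultimately show "\<exists>J\<subseteq>X. card J = p \<and> card (X - J) = q \<and> M = place b J c \<and>
           place b X c - M = place b (X - J) c"
    using eq X2 XX by (intro exI[of _ X1]) auto
qed

lemma coeff_sub_config:
  assumes f: "age_fun d f" and a: "exponent a" and J: "J \<subseteq> config a"
  shows "f (place b J letter) = coeff f (content J (\<lambda>x. x div Suc D))"
    and "exponent (content J (\<lambda>x. x div Suc D))" "weight (content J (\<lambda>x. x div Suc D)) = card J"
proof -
  have fin: "finite J" using J finite_config finite_subset by blast
  have J': "card J \<le> D" "\<And>x. x \<in> J \<Longrightarrow> x div Suc D < s"
    using card_mono[OF finite_config J] card_config[OF a] exponentD(2)[OF a] config_div(1)[OF a] subsetD[OF J] by auto
  show "f (place b J letter) = coeff f (content J (\<lambda>x. x div Suc D))"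
    using coeff_content[OF f fin J'(1), of "\<lambda>x. x div Suc D", OF div_le_mono J'(2)]
    by (simp only: letter_def[abs_def])
  show "exponent (content J (\<lambda>x. x div Suc D))" by (rule exponent_content[OF fin J'])
  show "weight (content J (\<lambda>x. x div Suc D)) = card J" by (rule sum_content[OF fin J'(2)])
qed

lemma content_split:
  assumes "finite X" "J \<subseteq> X"
  shows "content X p i = content J p i + content (X - J) p i"
proof -
  have "{x \<in> X. p x = i} = {x \<in> J. p x = i} \<union> {x \<in> X - J. p x = i}" using assms by auto
  then show ?thesis unfolding content_def using assms
    by (subst card_Un_disjoint[symmetric]) (auto intro: finite_subset)
qed

lemma conv_term_config:
  assumes f: "age_fun i f" and g: "age_fun j g" and lev: "level_le p f" "level_le q g"
    and a: "exponent a" "weight a = p + q"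
    and M: "M \<subseteq> place b (config a) letter" "f M * g (place b (config a) letter - M) \<noteq> 0"
  obtains a1 a2 where "exponent a1" "exponent a2" "weight a1 = p" "weight a2 = q" "a = (\<lambda>i. a1 i + a2 i)"
    "f M * g (place b (config a) letter - M) = coeff f a1 * coeff g a2"
proof -
  from conv_term_split(2)[OF lev finite_config letter_config[OF a(1)] M] a obtain J where
    J: "J \<subseteq> config a" "card J = p" "card (config a - J) = q" "M = place b J letter"
      "place b (config a) letter - M = place b (config a - J) letter"
    using card_config by auto
  let ?d = "\<lambda>x. x div Suc D"
  have D: "config a - J \<subseteq> config a" by blast
  have "a m = content J ?d m + content (config a - J) ?d m" for m
    using content_split[OF finite_config J(1), of ?d m] unfolding content_config[OF a(1)] .
  note sum = ext[OF this]
  show ?thesis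
  proof (rule that)
    show "a = (\<lambda>i. content J ?d i + content (config a - J) ?d i)" by (fact sum)
  qed (use coeff_sub_config[OF f a(1) J(1)] coeff_sub_config[OF g a(1) D] J in simp_all)
qed

text \<open>At the top level only splittings into whole blocks contribute, so exponents add as for
  monomials. Several splittings may give the leading exponent, but each nonzero term then has the
  same value, and nothing cancels.\<close>

lemma is_lead_conv:
  assumes f: "age_fun i f" and g: "age_fun j g" and lf: "is_lead f a" and lg: "is_lead g a'"
    and D: "i + j \<le> D"
  shows "is_lead (conv f g) (\<lambda>m. a m + a' m)"
proof -
  let ?s = "\<lambda>m. a m + a' m"
  let ?P = "\<lambda>c. place b (config c) letter"
  have a: "exponent a" "level_le (weight a) f" "coeff f a \<noteq> 0"
    and amax: "\<And>c. exponent c \<Longrightarrow> weight c = weight a \<Longrightarrow> coeff f c \<noteq> 0 \<Longrightarrow> \<not> lex_less s a c"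
    using lf by (auto simp: is_lead_def)
  have a': "exponent a'" "level_le (weight a') g" "coeff g a' \<noteq> 0"
    and a'max: "\<And>c. exponent c \<Longrightarrow> weight c = weight a' \<Longrightarrow> coeff g c \<noteq> 0 \<Longrightarrow> \<not> lex_less s a' c"
    using lg by (auto simp: is_lead_def)
  have ws: "weight ?s = weight a + weight a'" by (simp add: weight_def sum.distrib)
  have s: "exponent ?s"
    using exponentD(1)[OF a(1)] exponentD(1)[OF a'(1)] ws D
      coeff_nonzero_weight_le[OF f a(3,1)] coeff_nonzero_weight_le[OF g a'(3,1)]
    by (simp add: exponent_def)
  have "level_le (weight ?s) (conv f g)" unfolding level_le_def
  proof (intro allI impI, elim conjE)
    fix X :: "nat set" and c assume X: "finite X" "weight ?s < card X" "\<forall>x\<in>X. c x \<subseteq> F \<and> c x \<noteq> {}"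
    show "conv f g (place b X c) = 0" unfolding conv_def
    proof (rule sum.neutral, rule ballI, rule ccontr)
      fix M assume "M \<in> Pow (place b X c)" "f M * g (place b X c - M) \<noteq> 0"
      then show False using conv_term_split(1)[OF a(2) a'(2) X(1), of c M] X ws by auto
    qed
  qed
  moreover have dich: "(c = ?s \<and> f M * g (?P c - M) = coeff f a * coeff g a') \<or> lex_less s c ?s"
    if c: "exponent c" "weight c = weight ?s" and M: "M \<subseteq> ?P c" "f M * g (?P c - M) \<noteq> 0" for c M
  proof -
    obtain a1 a2 where a12: "exponent a1" "exponent a2" "weight a1 = weight a" "weight a2 = weight a'"
      "c = (\<lambda>i. a1 i + a2 i)" "f M * g (?P c - M) = coeff f a1 * coeff g a2"
      using conv_term_config[OF f g a(2) a'(2) c(1) c(2)[unfolded ws] M] by blast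
    have "coeff f a1 \<noteq> 0" "coeff g a2 \<noteq> 0" using a12(6) M(2) by auto
    then have "\<not> lex_less s a a1" "\<not> lex_less s a' a2" using amax a'max a12 by auto
    from lex_less_add[OF this] show ?thesis
    proof
      assume eq: "\<forall>i<s. a1 i = a i \<and> a2 i = a' i"
      have "a1 = a" "a2 = a'" using eq a12 a a' by (auto intro!: exponent_eqI)
      with a12 show ?thesis by simp
    qed (use a12 in simp)
  qed
  have "coeff (conv f g) c = 0" if c: "exponent c" "weight c = weight ?s" "lex_less s ?s c" for c
    unfolding coeff_def conv_def
  proof (rule sum.neutral, rule ballI, rule ccontr)
    fix M assume "M \<in> Pow (?P c)" "f M * g (?P c - M) \<noteq> 0"
    with dich[of c M] c lex_less_asym[of s ?s c] lex_less_asym[of s ?s ?s] show False by auto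
  qed
  moreover have "coeff (conv f g) ?s \<noteq> 0"
  proof -
    let ?K = "coeff f a * coeff g a'"
    let ?M = "?P a" and ?R = "config ?s - config a"
    let ?d = "\<lambda>x. x div Suc D"
    have K: "?K \<noteq> 0" using a a' by simp
    \<comment> \<open>\<open>config a\<close> takes the first slots of each letter. The remaining
      slots \<open>?R\<close> need not be \<open>config a'\<close>, but they have content
      \<open>a'\<close>, and that determines the value of \<open>g\<close>.\<close>
    have sub: "config a \<subseteq> config ?s" unfolding config_def by fastforce
    have "?P ?s - ?M = place b ?R letter"
    proof -
      have "b x y \<notin> ?M" if "x \<in> ?R" "y \<in> letter x" for x y
      proof
        assume "b x y \<in> ?M"
        then obtain x' y' where x': "x' \<in> config a" "y' \<in> letter x'" "b x y = b x' y'"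
          by (auto simp: place_def)
        then have "x = x'"
          using block_eq(1)[of x y x' y'] letter_config(1)[OF s, of x] letter_config(1)[OF a(1), of x'] that by blast
        with x' that show False by simp
      qed
      then have "?M \<inter> place b ?R letter = {}" by (auto simp: place_def[of b ?R])
      moreover have "?P ?s = place b (config a \<union> ?R) letter" using sub by (simp add: Un_absorb1)
      then have "?P ?s = ?M \<union> place b ?R letter" by (simp only: place_def UN_Un)
      ultimately show ?thesis by blast
    qed
    moreover have "content ?R ?d = a'"
    proof
      fix m
      show "content ?R ?d m = a' m"
        using content_split[OF finite_config sub, of ?d m]
        unfolding content_config[OF s] content_config[OF a(1)] by simp
    qed
    ultimately have gR: "g (?P ?s - ?M) = coeff g a'"
      using coeff_sub_config(1)[OF g s, of ?R] by simp
    have "?M \<subseteq> ?P ?s" using sub by (auto simp: place_def)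
    then have M: "?M \<in> Pow (?P ?s)" by simp
    have "finite (Pow (?P ?s))" using finite_place letter_config[OF s] by simp
    \<comment> \<open>Divided by \<open>?K\<close>, every term is 0 or 1, and the term of
      \<open>?M\<close> is 1.\<close>
    then have "0 < (\<Sum>M\<in>Pow (?P ?s). f M * g (?P ?s - M) / ?K)"
    proof (rule sum_pos2[OF _ M])
      show "0 < f ?M * g (?P ?s - ?M) / ?K" using gR K by (simp add: coeff_def)
      fix M assume "M \<in> Pow (?P ?s)"
      then show "0 \<le> f M * g (?P ?s - M) / ?K"
        using dich[OF s refl, of M] lex_less_asym[of s ?s ?s] by (cases "f M * g (?P ?s - M) = 0") auto
    qed
    then show ?thesis unfolding coeff_def conv_def sum_divide_distrib[symmetric] by auto
  qed
  ultimately show ?thesis using s by (auto simp: is_lead_def)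
qed

lemma leads_add:
  assumes "a \<in> leads i" "a' \<in> leads j" "i + j \<le> D"
  shows "(\<lambda>m. a m + a' m) \<in> leads (i + j)"
  using assms is_lead_conv age_fun_conv unfolding leads_def by blast

lemma zero_lead: "(\<lambda>_. 0) \<in> leads 0"
proof -
  let ?one = "\<lambda>P. if P = {} then 1 else (0 :: real)"
  have "level_le 0 ?one" unfolding level_le_def
  proof (intro allI impI, elim conjE)
    fix X :: "nat set" and c assume "finite X" "0 < card X" "\<forall>x\<in>X. c x \<subseteq> F \<and> c x \<noteq> {}"
    then have "place b X c \<noteq> {}" using card_le_card_place[of X c] by auto
    then show "?one (place b X c) = 0" by simp
  qed
  moreover have "\<not> lex_less s (\<lambda>_. 0) a" if "weight a = 0" for a
    using that by (auto simp: lex_less_def weight_def)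
  ultimately have "is_lead ?one (\<lambda>_. 0)"
    by (auto simp: is_lead_def exponent_def weight_def coeff_def config_def place_def)
  with age_fun_one show ?thesis unfolding leads_def by blast
qed

lemma leads_mult:
  assumes "a \<in> leads i" "r * i \<le> D"
  shows "(\<lambda>m. r * a m) \<in> leads (r * i)"
  using assms(2)
proof (induction r)
  case (Suc r)
  then have "(\<lambda>m. r * a m) \<in> leads (r * i)" by simp
  from leads_add[OF assms(1) this] Suc.prems show ?case by simp
qed (use zero_lead in simp)

lemma leads_sum:
  assumes "finite T" "T \<subseteq> leads i" "(\<Sum>t\<in>T. r t) * i \<le> D"
  shows "(\<lambda>m. \<Sum>t\<in>T. r t * t m) \<in> leads ((\<Sum>t\<in>T. r t) * i)"
  using assms
proof (induction T rule: finite_induct)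
  case (insert t T)
  then have le: "r t * i + (\<Sum>t\<in>T. r t) * i \<le> D" by (simp add: algebra_simps)
  then have "(\<lambda>m. r t * t m) \<in> leads (r t * i)" "(\<lambda>m. \<Sum>t\<in>T. r t * t m) \<in> leads ((\<Sum>t\<in>T. r t) * i)"
    using insert leads_mult by auto
  from leads_add[OF this le] insert show ?case by (simp add: algebra_simps)
qed (use zero_lead in simp)

end

text \<open>Every word of length at most \<open>n\<close> over the nonempty subsets of \<open>F\<close> is a subsequence of
  \<open>C 0, \<dots>, C (s - 1)\<close>; the words are indexed by finite sets of naturals.\<close>

definition spells :: "nat \<Rightarrow> 'a set \<Rightarrow> nat \<Rightarrow> (nat \<Rightarrow> 'a set) \<Rightarrow> bool" where
  "spells n F s C \<longleftrightarrow> (\<forall>(X :: nat set) c. finite X \<longrightarrow> card X \<le> n \<longrightarrow> (\<forall>x\<in>X. c x \<subseteq> F \<and> c x \<noteq> {}) \<longrightarrow>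
     (\<exists>p. (\<forall>x\<in>X. \<forall>y\<in>X. x \<le> y \<longrightarrow> p x \<le> p y) \<and> (\<forall>x\<in>X. p x < s \<and> C (p x) = c x)))"

section \<open>Comparison of the numbers of leads and types\<close>

context homogeneous_blocks
begin

lemma leadsD:
  assumes "a \<in> leads d"
  shows "exponent a" "weight a \<le> d"
  using assms coeff_nonzero_weight_le by (auto simp: leads_def is_lead_def)

lemma finite_leads: "finite (leads d)"
  by (rule finite_subset[OF _ finite_exponents]) (use leadsD in auto)

lemma coeff_sum: "coeff (\<lambda>P. \<Sum>i\<in>I. x i * f i P) a = (\<Sum>i\<in>I. x i * coeff (f i) a)"
  by (simp add: coeff_def)

lemma coeff_above_lead:
  assumes "is_lead f a" "exponent a'" "weight a < weight a' \<or> weight a = weight a' \<and> lex_less s a a'"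
  shows "coeff f a' = 0"
  using assms(3)
proof
  assume less: "weight a < weight a'"
  have "level_le (weight a) f" using assms(1) by (simp add: is_lead_def)
  then show ?thesis
    unfolding level_le_def coeff_def using letter_config[OF assms(2)] card_config[OF assms(2)] less by simp
qed (use assms in \<open>auto simp: is_lead_def\<close>)

text \<open>Age functions with distinct leads are linearly independent. With more leads than types,
  some nontrivial combination would vanish on all types, but at the largest lead that occurs in it
  only one function has a nonzero coefficient.\<close>

lemma card_leads_le: "card (leads d) \<le> card (types d)"
proof (rule ccontr)
  assume "\<not> ?thesis"
  then have less: "card (types d) < card (leads d)" by simp
  have "\<forall>a\<in>leads d. \<exists>f. age_fun d f \<and> is_lead f a" by (auto simp: leads_def)
  then obtain f where f: "\<And>a. a \<in> leads d \<Longrightarrow> age_fun d (f a)" "\<And>a. a \<in> leads d \<Longrightarrow> is_lead (f a) a"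
    by metis
  have "\<forall>\<sigma>\<in>types d. \<exists>A. A \<subseteq> E \<and> finite A \<and> \<tau> A = \<sigma>" by (auto simp: types_def)
  then obtain rep where rep: "\<And>\<sigma>. \<sigma> \<in> types d \<Longrightarrow> rep \<sigma> \<subseteq> E \<and> finite (rep \<sigma>) \<and> \<tau> (rep \<sigma>) = \<sigma>" by metis
  have fin: "finite (types d)" unfolding types_def by (rule finite_types)
  obtain x a0 where x: "a0 \<in> leads d" "x a0 \<noteq> 0" "\<And>\<sigma>. \<sigma> \<in> types d \<Longrightarrow> (\<Sum>a\<in>leads d. f a (rep \<sigma>) * x a) = 0"
    using homogeneous_system_nontrivial_solution[OF fin finite_leads less, of "\<lambda>\<sigma> a. f a (rep \<sigma>)"] by blast
  define G where "G P = (\<Sum>a\<in>leads d. x a * f a P)" for P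
  have G: "age_fun d G" unfolding G_def using f(1) by (rule age_fun_sum)
  have G0: "G P = 0" for P
  proof (rule ccontr)
    assume nz: "G P \<noteq> 0"
    note P = age_funD[OF G nz]
    then have \<tau>: "\<tau> P \<in> types d" by (auto simp: types_def)
    have "G P = G (rep (\<tau> P))" using rep[OF \<tau>] by (intro age_fun_eq[OF G P(1,2)]) auto
    also have "\<dots> = 0" using x(3)[OF \<tau>] by (simp add: G_def mult.commute)
    finally show False using nz by simp
  qed
  define less where "less a a' \<longleftrightarrow> weight a < weight a' \<or> weight a = weight a' \<and> lex_less s a a'" for a a'
  let ?J = "{a \<in> leads d. x a \<noteq> 0}"
  have "asymp_on ?J less" by (rule asymp_onI) (auto simp: less_def dest: lex_less_asym)
  moreover have "transp_on ?J less" by (rule transp_onI) (auto simp: less_def intro: lex_less_trans)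
  ultimately obtain m where m: "m \<in> ?J" "\<forall>a\<in>?J. a \<noteq> m \<longrightarrow> \<not> less m a"
    using Finite_Set.bex_max_element[of ?J less] finite_leads x by auto
  have "x a * coeff (f a) m = 0" if "a \<in> leads d" "a \<noteq> m" for a
  proof (cases "x a = 0")
    case False
    then have "\<not> less m a" using m(2) that by simp
    moreover have "less m a \<or> less a m"
    proof (rule ccontr)
      assume "\<not> ?thesis"
      then have "weight m = weight a" "\<not> lex_less s m a" "\<not> lex_less s a m" by (auto simp: less_def)
      then have "a = m" using that m leadsD(1) lex_less_total by (auto intro!: exponent_eqI)
      with that show False by simp
    qed
    ultimately have "less a m" by simp
    then show ?thesis using coeff_above_lead[OF f(2)[OF that(1)], of m] m(1) leadsD(1)[of m d] by (simp add: less_def)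
  qed simp
  then have "(\<Sum>a\<in>leads d - {m}. x a * coeff (f a) m) = 0" by (intro sum.neutral ballI) blast
  then have "coeff G m = x m * coeff (f m) m"
    unfolding G_def coeff_sum using m(1) finite_leads by (simp add: sum.remove[of _ m])
  moreover have "coeff G m = 0" by (simp add: coeff_def G0)
  moreover have "coeff (f m) m \<noteq> 0" using m(1) f(2)[of m] unfolding is_lead_def by blast
  ultimately show False using m(1) by simp
qed

text \<open>A copy of \<open>P\<close> inside one block shows that \<open>f\<close> is nonzero at
  some word. A longest such word fixes the level; since \<open>C\<close> spells it, some exponent of
  that weight has a nonzero coefficient, and a lexicographically largest one is a lead.\<close>

lemma ex_lead:
  assumes f: "age_fun n f" "f P \<noteq> 0" and D: "n \<le> D"
    and cover: "\<forall>P. P \<subseteq> E \<longrightarrow> finite P \<longrightarrow> card P = n \<longrightarrow> (\<exists>M\<subseteq>F. \<tau> M = \<tau> P)"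
    and words: "spells n F s C"
  shows "\<exists>a. is_lead f a"
proof -
  note P = age_funD[OF f]
  obtain M where M: "M \<subseteq> F" "\<tau> M = \<tau> P" using cover P by blast
  have "finite M" "M \<subseteq> E" using M F finite_subset by auto
  have "f (b 0 ` M) = f P"
    using block_type[OF M(1), of 0] M block_sub[of 0] \<open>finite M\<close>
    by (intro age_fun_eq[OF f(1) _ _ P(1,2)]) auto
  then have nz: "f (b 0 ` M) \<noteq> 0" using f(2) by simp
  define Q where "Q l \<longleftrightarrow> (\<exists>X c. finite X \<and> (\<forall>x\<in>X. c x \<subseteq> F \<and> c x \<noteq> {}) \<and> f (place b X c) \<noteq> 0 \<and> card X = l)" for l
  have Qn: "l \<le> n" if "Q l" for l
  proof -
    from that obtain X :: "nat set" and c where X: "finite X" "\<forall>x\<in>X. c x \<subseteq> F \<and> c x \<noteq> {}" "f (place b X c) \<noteq> 0" "card X = l"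
      unfolding Q_def by blast
    with age_funD(3)[OF f(1) X(3)] card_le_card_place[of X c] show ?thesis by auto
  qed
  \<comment> \<open>Letters are nonempty, so the empty set is spelled by the empty word and any
    other \<open>M\<close> by a single letter in block 0.\<close>
  have "Q (card (if M = {} then {} else {0::nat}))" unfolding Q_def
    using M nz by (intro exI[of _ "if M = {} then {} else {0}"] exI[of _ "\<lambda>_. M"]) (auto simp: place_def)
  then have "\<exists>l. Q l \<and> (\<forall>l'. Q l' \<longrightarrow> l' \<le> l)" by (intro Nat.ex_has_greatest_nat) (use Qn in auto)
  then obtain l where l: "Q l" "\<And>l'. Q l' \<Longrightarrow> l' \<le> l" by blast
  from l(1) obtain X :: "nat set" and c where X: "finite X" "\<forall>x\<in>X. c x \<subseteq> F \<and> c x \<noteq> {}" "f (place b X c) \<noteq> 0" "card X = l"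
    unfolding Q_def by blast
  have lev: "level_le l f" unfolding level_le_def
  proof (intro allI impI, elim conjE, rule ccontr)
    fix X :: "nat set" and c assume "finite X" "l < card X" "\<forall>x\<in>X. c x \<subseteq> F \<and> c x \<noteq> {}" "f (place b X c) \<noteq> 0"
    then have "Q (card X)" unfolding Q_def by blast
    with l(2) \<open>l < card X\<close> show False by fastforce
  qed
  have ln: "l \<le> n" using Qn l(1) by simp
  have "\<exists>p. (\<forall>x\<in>X. \<forall>y\<in>X. x \<le> y \<longrightarrow> p x \<le> p y) \<and> (\<forall>x\<in>X. p x < s \<and> C (p x) = c x)"
    using words[unfolded spells_def, rule_format, of X c] X ln by simp
  then obtain p where p: "\<And>x y. x \<in> X \<Longrightarrow> y \<in> X \<Longrightarrow> x \<le> y \<Longrightarrow> p x \<le> p y" "\<And>x. x \<in> X \<Longrightarrow> p x < s" "\<And>x. x \<in> X \<Longrightarrow> C (p x) = c x"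
    by blast
  have XD: "card X \<le> D" using X(4) ln D by simp
  have "place b X (\<lambda>x. C (p x)) = place b X c" by (rule place_cong) (rule p(3))
  then have "coeff f (content X p) \<noteq> 0" using coeff_content[of n f X p, OF f(1) X(1) XD p(1,2)] X(3) by simp
  moreover have "exponent (content X p)" by (rule exponent_content[OF X(1) XD p(2)])
  moreover have "weight (content X p) = l" using sum_content[OF X(1) p(2)] X(4) by simp
  ultimately have ne: "content X p \<in> {a. exponent a \<and> weight a = l \<and> coeff f a \<noteq> 0}" (is "_ \<in> ?A") by simp
  have "finite ?A" by (rule finite_subset[OF _ finite_exponents]) auto
  moreover have "asymp_on ?A (lex_less s)" by (rule asymp_onI) (rule lex_less_asym)
  moreover have "transp_on ?A (lex_less s)" by (rule transp_onI) (rule lex_less_trans)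
  ultimately obtain m where m: "m \<in> ?A" "\<forall>a\<in>?A. a \<noteq> m \<longrightarrow> \<not> lex_less s m a"
    using Finite_Set.bex_max_element[of ?A "lex_less s"] ne by blast
  have "is_lead f m" unfolding is_lead_def
  proof (intro conjI allI impI; (elim conjE)?)
    fix a assume a: "exponent a" "weight a = weight m" "lex_less s m a"
    then have "a \<noteq> m" using lex_less_asym by blast
    then show "coeff f a = 0" using m a by auto
  qed (use m lev in auto)
  then show ?thesis by blast
qed

text \<open>With fewer leads than types, some nontrivial combination of the indicator functions of
  types would have coefficient zero at every lead of degree \<open>n\<close>. It is a nonzero age
  function, so its own lead contradicts this.\<close>

lemma card_types_le_card_leads:
  assumes D: "n \<le> D"
    and cover: "\<forall>P. P \<subseteq> E \<longrightarrow> finite P \<longrightarrow> card P = n \<longrightarrow> (\<exists>M\<subseteq>F. \<tau> M = \<tau> P)"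
    and words: "spells n F s C"
  shows "card (types n) \<le> card (leads n)"
proof (rule ccontr)
  assume "\<not> ?thesis"
  then have less: "card (leads n) < card (types n)" by simp
  define e where "e \<sigma> P = (if P \<subseteq> E \<and> finite P \<and> card P = n then if \<tau> P = \<sigma> then 1 else 0 else 0 :: real)" for \<sigma> P
  have e: "age_fun n (e \<sigma>)" for \<sigma>
    unfolding e_def[abs_def] by (rule age_fun_of_types[of n "\<lambda>\<rho>. if \<rho> = \<sigma> then 1 else 0"])
  have fin: "finite (types n)" unfolding types_def by (rule finite_types)
  obtain x \<sigma>0 where x: "\<sigma>0 \<in> types n" "x \<sigma>0 \<noteq> 0" "\<And>a. a \<in> leads n \<Longrightarrow> (\<Sum>\<sigma>\<in>types n. coeff (e \<sigma>) a * x \<sigma>) = 0"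
    using homogeneous_system_nontrivial_solution[OF finite_leads fin less, of "\<lambda>a \<sigma>. coeff (e \<sigma>) a"] by blast
  define f where "f P = (\<Sum>\<sigma>\<in>types n. x \<sigma> * e \<sigma> P)" for P
  have f: "age_fun n f" unfolding f_def using e by (rule age_fun_sum)
  obtain P where P: "P \<subseteq> E" "finite P" "card P = n" "\<tau> P = \<sigma>0" using x(1) by (auto simp: types_def)
  have "f P = (\<Sum>\<sigma>\<in>types n. if \<sigma> = \<sigma>0 then x \<sigma> else 0)"
    unfolding f_def using P by (intro sum.cong) (auto simp: e_def)
  then have "f P \<noteq> 0" using x fin by simp
  from ex_lead[OF f this D cover words] obtain a where a: "is_lead f a" by blast
  with f have "a \<in> leads n" by (auto simp: leads_def)
  then have "coeff f a = 0" unfolding f_def coeff_sum using x(3)[of a] by (simp add: mult.commute)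
  with a show False unfolding is_lead_def by blast
qed

end

section \<open>Construction of the blocks and the bound on the number of types\<close>

context inexhaustible_types
begin

lemma ex_homogeneous_blocks:
  "\<exists>F b s C. homogeneous_blocks E \<tau> F b D s C \<and> spells n F s C \<and>
     (\<forall>P. P \<subseteq> E \<longrightarrow> finite P \<longrightarrow> card P = n \<longrightarrow> (\<exists>M\<subseteq>F. \<tau> M = \<tau> P))"
proof -
  have "\<forall>\<sigma>\<in>types n. \<exists>A. A \<subseteq> E \<and> finite A \<and> \<tau> A = \<sigma>" by (auto simp: types_def)
  then obtain rep where rep: "\<And>\<sigma>. \<sigma> \<in> types n \<Longrightarrow> rep \<sigma> \<subseteq> E \<and> finite (rep \<sigma>) \<and> \<tau> (rep \<sigma>) = \<sigma>" by metis
  define F where "F = (\<Union>\<sigma>\<in>types n. rep \<sigma>)"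
  have F: "F \<subseteq> E" "finite F"
    unfolding F_def using rep finite_types[of n] by (auto simp: types_def)
  obtain b :: "nat \<Rightarrow> 'a \<Rightarrow> 'a" where
    b: "\<forall>x. inj_on (b x) F \<and> b x ` F \<subseteq> E \<and> (\<forall>M\<subseteq>F. \<tau> (b x ` M) = \<tau> M)"
    and disj: "\<forall>x y. x \<noteq> y \<longrightarrow> b x ` F \<inter> b y ` F = {}"
    and hom: "\<forall>X h c. finite X \<and> card X \<le> D \<and> strict_mono_on X h \<and> (\<forall>x\<in>X. c (h x) \<subseteq> F) \<longrightarrow>
              \<tau> (place b X (c \<circ> h)) = \<tau> (place b (h ` X) c)"
    using homogeneous_block_sequence[OF F, of D] by (elim exE conjE)
  have "finite (Pow F - {{}})" using F by simp
  from finite_list[OF this] obtain cs where cs: "set cs = Pow F - {{}}" by blast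
  \<comment> \<open>\<open>C\<close> runs through all nonempty subsets of \<open>F\<close> again and
    again, \<open>n\<close> rounds in all. Each letter of a word is found in the round given by its
    rank in the word.\<close>
  define C where "C i = cs ! (i mod length cs)" for i
  let ?s = "n * length cs"
  have lts: "C i \<subseteq> F \<and> C i \<noteq> {}" if "i < ?s" for i
  proof -
    have "0 < length cs" using that by (cases cs) auto
    then have "C i \<in> set cs" unfolding C_def by simp
    then show ?thesis using cs by simp
  qed
  have blocks: "homogeneous_blocks E \<tau> F b D ?s C"
  proof (unfold_locales, goal_cases)
    case (1) show ?case by (rule F)
  next
    case (2) show ?case by (rule F)
  next
    case (3 x) show ?case using b by blast
  next
    case (4 x) show ?case using b by blast
  next
    case (5 M x) then show ?case using b by blast
  next
    case (6 x y) then show ?case using disj by blast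
  next
    case (7 X h c) then show ?case using hom by blast
  next
    case (8 i) then show ?case using lts by blast
  next
    case (9 i) then show ?case using lts by blast
  qed
  have cover: "\<exists>M\<subseteq>F. \<tau> M = \<tau> P" if "P \<subseteq> E" "finite P" "card P = n" for P
  proof -
    have \<tau>: "\<tau> P \<in> types n" using that by (auto simp: types_def)
    then show ?thesis using rep[OF \<tau>] by (intro exI[of _ "rep (\<tau> P)"]) (auto simp: F_def)
  qed
  have words: "\<exists>p. (\<forall>x\<in>X. \<forall>y\<in>X. x \<le> y \<longrightarrow> p x \<le> p y) \<and> (\<forall>x\<in>X. p x < ?s \<and> C (p x) = c x)"
    if X: "finite X" "card X \<le> n" and c: "\<And>x. x \<in> X \<Longrightarrow> c x \<subseteq> F \<and> c x \<noteq> {}" for X :: "nat set" and c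
  proof -
    let ?r = "length cs"
    have "\<forall>x\<in>X. \<exists>i<?r. cs ! i = c x" using c cs by (auto simp: in_set_conv_nth[symmetric])
    then obtain e where e: "\<And>x. x \<in> X \<Longrightarrow> e x < ?r" "\<And>x. x \<in> X \<Longrightarrow> cs ! e x = c x" by metis
    define rank where "rank x = card {y \<in> X. y < x}" for x
    define p where "p x = rank x * ?r + e x" for x
    have rank_less: "rank x < rank y" if "x \<in> X" "y \<in> X" "x < y" for x y
      unfolding rank_def using X that by (intro psubset_card_mono) auto
    have rank_n: "rank x < n" if "x \<in> X" for x
    proof -
      have "rank x < card X" unfolding rank_def using X that by (intro psubset_card_mono) auto
      then show ?thesis using X by simp
    qed
    have step: "rank x * ?r + e x < m * ?r" if "x \<in> X" "rank x < m" for x m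
    proof -
      have "Suc (rank x) * ?r \<le> m * ?r" using that by (intro mult_le_mono1) simp
      then show ?thesis using e(1)[OF that(1)] by simp
    qed
    have "p x \<le> p y" if "x \<in> X" "y \<in> X" "x \<le> y" for x y
    proof (cases "x = y")
      case False
      then have "p x < rank y * ?r" unfolding p_def using that rank_less by (intro step) auto
      then show ?thesis by (simp add: p_def)
    qed simp
    moreover have "p x < ?s" if "x \<in> X" for x unfolding p_def using that rank_n by (intro step) auto
    moreover have "C (p x) = c x" if "x \<in> X" for x using e[OF that] by (simp add: C_def p_def)
    ultimately show ?thesis by blast
  qed
  have "spells n F ?s C" unfolding spells_def
    by (intro allI impI words) auto
  with blocks cover show ?thesis by blast
qed

lemma card_types_le_choose:
  assumes growth: "\<And>m. m \<ge> N \<Longrightarrow> real (card (types m)) \<le> \<beta> * real m ^ k" and "\<beta> \<ge> 0"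
  shows "card (types n) \<le> (n + k) choose k"
proof (cases "n = 0")
  case True
  have "types 0 \<subseteq> {\<tau> {}}" by (auto simp: types_def)
  then have "card (types 0) \<le> 1" using card_mono[of "{\<tau> {}}" "types 0"] by simp
  then show ?thesis using True by simp
next
  case False
  \<comment> \<open>\<open>p0\<close> absorbs the constant factor of the growth bound at
    \<open>m * n = n * Suc k * p\<close>, so that for \<open>p > p0\<close> the bound is at most
    \<open>p ^ Suc k\<close>. The factor \<open>Suc k\<close> in \<open>m\<close> leaves room for
    \<open>Suc k\<close> multiplicities up to \<open>p\<close>.\<close>
  obtain p0 :: nat where p0: "\<beta> * real (n * Suc k) ^ k \<le> real p0" using real_arch_simple by blast
  define p where "p = Suc (N + p0)"
  define m where "m = p * Suc k"
  have nm: "m * n \<ge> N" "m * n \<ge> n"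
  proof -
    have "p * 1 \<le> p * (Suc k * n)" using False by (intro mult_le_mono2) simp
    then have "p \<le> m * n" unfolding m_def mult.assoc mult_1_right .
    then show "m * n \<ge> N" by (simp add: p_def)
    show "m * n \<ge> n" by (simp add: m_def p_def)
  qed
  obtain F b s C where "homogeneous_blocks E \<tau> F b (m * n) s C"
    and cover: "\<forall>P. P \<subseteq> E \<longrightarrow> finite P \<longrightarrow> card P = n \<longrightarrow> (\<exists>M\<subseteq>F. \<tau> M = \<tau> P)"
    and words: "spells n F s C"
    \<comment> \<open>The parameter \<open>D\<close> is \<open>m * n\<close>, the degree of the
      \<open>m\<close>-fold sums of leads of degree \<open>n\<close> formed below.\<close>
    using ex_homogeneous_blocks[of "m * n" n] by (elim exE conjE)
  then interpret homogeneous_blocks E \<tau> F b "m * n" s C by simp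
  have ge: "card (types n) \<le> card (leads n)" by (rule card_types_le_card_leads[OF nm(2) cover words])
  show ?thesis
  proof (cases "leads n = {}")
    case True
    with ge show ?thesis by simp
  next
    case False
    show ?thesis
    proof (rule coordinates_or_affinely_independent[of "{..<s}" "leads n" "Suc k", THEN disjE])
      show "t i = 0" if "t \<in> leads n" "i \<notin> {..<s}" for t i
        using that leadsD(1) exponentD(1) by simp
    next
      assume "\<exists>K\<subseteq>{..<s}. card K < Suc k \<and> inj_on (\<lambda>t. restrict t K) (leads n)"
      then obtain K where K: "K \<subseteq> {..<s}" "card K \<le> k" "inj_on (\<lambda>t. restrict t K) (leads n)" by auto
      have "finite K" using K(1) finite_subset by blast
      moreover have "sum t K \<le> n" if "t \<in> leads n" for t
      proof -
        have "sum t K \<le> weight t" unfolding weight_def using K(1) by (intro sum_mono2) auto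
        then show ?thesis using leadsD(2)[OF that] by simp
      qed
      ultimately have "card (leads n) \<le> (n + k) choose k" using K card_le_choose_if_coordinates by blast
      with ge show ?thesis by simp
    next
      assume "\<exists>K\<subseteq>{..<s}. \<exists>T\<subseteq>leads n. finite T \<and> card K = Suc k \<and> card T = Suc (Suc k) \<and> affinely_independent_on K T"
      then obtain K T where T: "T \<subseteq> leads n" "finite T" "card T = Suc (Suc k)" "affinely_independent_on K T" by blast
      then obtain t0 where t0: "t0 \<in> T" by (metis card.empty ex_in_conv nat.distinct(1))
      let ?T = "T - {t0}"
      have cT: "card ?T = Suc k" "finite ?T" using T t0 by auto
      \<comment> \<open>The multiplicities on \<open>?T\<close> are free between 0 and
        \<open>p\<close>; \<open>t0\<close> receives the rest, so that they always sum to
        \<open>m\<close>.\<close>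
      define ext where "ext g = (\<lambda>t. if t = t0 then m - sum g ?T else g t)" for g :: "(nat \<Rightarrow> nat) \<Rightarrow> nat"
      define \<Phi> where "\<Phi> g = (\<lambda>i. \<Sum>t\<in>T. ext g t * t i)" for g
      let ?G = "?T \<rightarrow>\<^sub>E {..p}"
      have sum_ext: "sum (ext g) T = m" if "g \<in> ?G" for g
      proof -
        have "sum g ?T \<le> of_nat (card ?T) * p" using that by (intro sum_bounded_above) auto
        then have "sum g ?T \<le> m" unfolding cT(1) m_def by (simp add: mult.commute)
        moreover have "sum (ext g) ?T = sum g ?T" by (rule sum.cong) (auto simp: ext_def)
        ultimately show ?thesis using t0 T(2) by (simp add: sum.remove[of T t0] ext_def)
      qed
      have img: "\<Phi> g \<in> leads (m * n)" if "g \<in> ?G" for g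
        using leads_sum[OF T(2,1), of "ext g"] sum_ext[OF that] by (simp add: \<Phi>_def)
      \<comment> \<open>Two choices with the same sum vector would differ by an affine relation on
        \<open>T\<close>. Hence there are \<open>Suc p ^ Suc k\<close> leads of degree
        \<open>m * n\<close>, too many for the growth bound.\<close>
      have inj: "inj_on \<Phi> ?G"
      proof (rule inj_onI)
        fix g g' assume g: "g \<in> ?G" "g' \<in> ?G" "\<Phi> g = \<Phi> g'"
        let ?c = "\<lambda>t. real (ext g t) - real (ext g' t)"
        have "(\<Sum>t\<in>T. ?c t) = 0"
          using sum_ext[OF g(1)] sum_ext[OF g(2)] by (simp add: sum_subtractf flip: of_nat_sum)
        moreover have "(\<Sum>t\<in>T. ?c t * real (t i)) = 0" for i
        proof -
          have "(\<Sum>t\<in>T. ?c t * real (t i)) = real (\<Phi> g i) - real (\<Phi> g' i)"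
            by (simp add: \<Phi>_def left_diff_distrib sum_subtractf)
          then show ?thesis using g(3) by simp
        qed
        ultimately have eq: "\<forall>t\<in>T. ?c t = 0"
          using T(4) unfolding affinely_independent_on_def by blast
        show "g = g'"
        proof (rule PiE_ext[OF g(1,2)])
          fix t assume "t \<in> ?T"
          then have t: "t \<in> T" "t \<noteq> t0" by auto
          then have "real (ext g t) = real (ext g' t)" using bspec[OF eq t(1)] by simp
          then show "g t = g' t" using t(2) by (simp add: ext_def)
        qed
      qed
      have "Suc p ^ Suc k = card ?G" using cT by (simp add: card_PiE)
      also have "\<dots> \<le> card (leads (m * n))"
        using img inj finite_leads by (intro card_inj_on_le) auto
      also have "\<dots> \<le> card (types (m * n))" by (rule card_leads_le)
      finally have "real (Suc p ^ Suc k) \<le> \<beta> * real (m * n) ^ k" using growth[OF nm(1)] by linarith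
      also have "\<dots> = \<beta> * real (n * Suc k) ^ k * real p ^ k"
      proof -
        have "m * n = n * Suc k * p" by (simp only: m_def mult_ac)
        then show ?thesis by (simp only: of_nat_mult power_mult_distrib mult.assoc)
      qed
      also have "\<dots> \<le> real p * real p ^ k" using p0 by (intro mult_right_mono) (auto simp: p_def)
      also have "\<dots> = real p ^ Suc k" by simp
      also have "\<dots> < real (Suc p) ^ Suc k" by (intro power_strict_mono) auto
      finally show ?thesis by (simp only: of_nat_power less_irrefl)
    qed (use False in simp_all)
  qed
qed

end

subsection \<open>Isomorphism types of finite induced substructures\<close>

lemma univ_induced [simp]: "univ (induced R A) = A"
  by (simp add: induced_def)

lemma same_signature_induced [simp]: "same_signature (induced R A) (induced R B)"
  by (simp add: same_signature_def induced_def)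

lemma embeddingD:
  assumes "embedding f S T"
  shows "same_signature S T" "inj_on f (univ S)" "f ` univ S \<subseteq> univ T"
    and "\<And>i xs. i \<in> index S \<Longrightarrow> xs \<in> tuples (univ S) (arity S i) \<Longrightarrow> xs \<in> rel S i \<longleftrightarrow> map f xs \<in> rel T i"
proof -
  note e = assms[unfolded embedding_def]
  show "same_signature S T" by (rule e[THEN conjunct1])
  show "inj_on f (univ S)" by (rule e[THEN conjunct2, THEN conjunct1])
  show "f ` univ S \<subseteq> univ T" by (rule e[THEN conjunct2, THEN conjunct2, THEN conjunct1])
  show "\<And>i xs. i \<in> index S \<Longrightarrow> xs \<in> tuples (univ S) (arity S i) \<Longrightarrow> xs \<in> rel S i \<longleftrightarrow> map f xs \<in> rel T i"
    by (rule e[THEN conjunct2, THEN conjunct2, THEN conjunct2, rule_format])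
qed

lemma embedding_compose:
  assumes f: "embedding f S T" and g: "embedding g T U"
  shows "embedding (g \<circ> f) S U"
proof -
  have fg: "inj_on f (univ S)" "inj_on g (univ T)" "f ` univ S \<subseteq> univ T" "g ` univ T \<subseteq> univ U"
    and sig: "same_signature S T" "same_signature T U"
    by (fact embeddingD[OF f] embeddingD[OF g])+
  have "same_signature S U" using sig by (simp add: same_signature_def)
  moreover have "inj_on (g \<circ> f) (univ S)" by (rule comp_inj_on[OF fg(1) inj_on_subset[OF fg(2,3)]])
  moreover have "(g \<circ> f) ` univ S \<subseteq> univ U" using fg by fastforce
  moreover have "xs \<in> rel S i \<longleftrightarrow> map (g \<circ> f) xs \<in> rel U i"
    if i: "i \<in> index S" and xs: "xs \<in> tuples (univ S) (arity S i)" for i xs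
  proof -
    have i': "i \<in> index T" "arity S i = arity T i" using sig(1) i by (auto simp: same_signature_def)
    have "map f xs \<in> tuples (univ T) (arity T i)" using xs fg(3) i' by (fastforce simp: tuples_def)
    from embeddingD(4)[OF g i'(1) this] embeddingD(4)[OF f i xs] show ?thesis by simp
  qed
  ultimately show ?thesis unfolding embedding_def by (intro conjI ballI)
qed

lemma isomorphic_refl: "isomorphic S S"
  unfolding isomorphic_def embedding_def same_signature_def by (intro exI[of _ id]) simp

lemma isomorphic_trans:
  assumes "isomorphic S T" "isomorphic T U"
  shows "isomorphic S U"
proof -
  from assms obtain f g where "embedding f S T" "f ` univ S = univ T" "embedding g T U" "g ` univ T = univ U"
    unfolding isomorphic_def by blast
  then show ?thesis unfolding isomorphic_def
    by (intro exI[of _ "g \<circ> f"] conjI embedding_compose) (simp_all only: image_comp[symmetric])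
qed

lemma isomorphic_sym:
  assumes "isomorphic S T"
  shows "isomorphic T S"
proof -
  from assms obtain f where f: "embedding f S T" "f ` univ S = univ T" unfolding isomorphic_def by blast
  let ?g = "the_inv_into (univ S) f"
  have inj: "inj_on f (univ S)" and sig: "same_signature S T" using f by (auto simp: embedding_def)
  have img: "?g ` univ T = univ S" using f(2) inj by (simp add: the_inv_into_onto flip: f(2))
  have "xs \<in> rel T i \<longleftrightarrow> map ?g xs \<in> rel S i" if "i \<in> index T" "xs \<in> tuples (univ T) (arity T i)" for i xs
  proof -
    have xs: "set xs \<subseteq> univ T" "length xs = arity T i" using that by (auto simp: tuples_def)
    then have "map ?g xs \<in> tuples (univ S) (arity S i)"
      using img sig that(1) by (auto simp: tuples_def same_signature_def)
    moreover have "map f (map ?g xs) = xs"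
      using xs f(2) f_the_inv_into_f[OF inj] by (auto intro!: map_idI)
    ultimately show ?thesis using f(1) that(1) sig by (auto simp: embedding_def same_signature_def)
  qed
  moreover have "inj_on ?g (univ T)" using inj_on_the_inv_into[OF inj] f(2) by simp
  ultimately have "embedding ?g T S" using img sig by (auto simp: embedding_def same_signature_def)
  then show ?thesis using img unfolding isomorphic_def by blast
qed

lemma induced_mem_iso_type:
  assumes "relational_structure R"
  shows "induced R A \<in> iso_type (induced R A)"
  using assms isomorphic_refl by (auto simp: iso_type_def relational_structure_def induced_def)

lemma iso_type_eq_iff:
  assumes "relational_structure R"
  shows "iso_type (induced R A) = iso_type (induced R B) \<longleftrightarrow> isomorphic (induced R A) (induced R B)"
proof
  assume "iso_type (induced R A) = iso_type (induced R B)"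
  then have "induced R A \<in> iso_type (induced R B)" using induced_mem_iso_type[OF assms, of A] by simp
  then show "isomorphic (induced R A) (induced R B)" by (auto simp: iso_type_def intro: isomorphic_sym)
next
  assume "isomorphic (induced R A) (induced R B)"
  then show "iso_type (induced R A) = iso_type (induced R B)"
    unfolding iso_type_def by (intro Collect_cong) (metis isomorphic_trans isomorphic_sym)
qed

lemma embedding_image_isomorphic:
  assumes "embedding f (induced R A) (induced R B)" "X \<subseteq> A"
  shows "isomorphic (induced R X) (induced R (f ` X))"
proof -
  have "xs \<in> rel (induced R X) i \<longleftrightarrow> map f xs \<in> rel (induced R (f ` X)) i"
    if "i \<in> index R" "xs \<in> tuples X (arity R i)" for i xs
  proof -
    have xs: "set xs \<subseteq> X" "length xs = arity R i" using that(2) by (auto simp: tuples_def)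
    then have "xs \<in> tuples A (arity R i)" using assms(2) by (auto simp: tuples_def)
    then have "xs \<in> rel (induced R A) i \<longleftrightarrow> map f xs \<in> rel (induced R B) i"
      using assms(1) that(1) by (auto simp: embedding_def induced_def)
    moreover have "f ` A \<subseteq> B" using assms(1) by (auto simp: embedding_def)
    ultimately show ?thesis using xs assms(2) by (auto simp: induced_def tuples_def)
  qed
  moreover have "inj_on f X" using assms by (auto simp: embedding_def intro: inj_on_subset)
  ultimately have "embedding f (induced R X) (induced R (f ` X))"
    by (auto simp: embedding_def) (auto simp: induced_def)
  then show ?thesis unfolding isomorphic_def by auto
qed

lemma relational_structure_inexhaustible_types:
  assumes R: "relational_structure R" and inex: "inexhaustible (age R)"
    and fin: "\<And>n. finite {iso_type (induced R A) |A. A \<subseteq> univ R \<and> finite A \<and> card A = n}"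
  shows "inexhaustible_types (univ R) (\<lambda>A. iso_type (induced R A))"
proof
  fix A B assume "A \<subseteq> univ R" "finite A" "B \<subseteq> univ R" "finite B"
    and "iso_type (induced R A) = iso_type (induced R B)"
  then have "isomorphic (induced R A) (induced R B)" using iso_type_eq_iff[OF R] by simp
  then obtain h where h: "embedding h (induced R A) (induced R B)" "h ` A = B" by (auto simp: isomorphic_def)
  have "bij_betw h A B" using embeddingD(2)[OF h(1)] h(2) by (simp add: bij_betw_def)
  moreover have "iso_type (induced R (h ` X)) = iso_type (induced R X)" if "X \<subseteq> A" for X
    using isomorphic_sym[OF embedding_image_isomorphic[OF h(1) that]] iso_type_eq_iff[OF R] by simp
  ultimately show "\<exists>h. bij_betw h A B \<and> (\<forall>X\<subseteq>A. iso_type (induced R (h ` X)) = iso_type (induced R X))" by blast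
next
  fix A B assume A: "A \<subseteq> univ R" "finite A" and B: "B \<subseteq> univ R" "finite B"
  have "iso_type (induced R A) \<in> age R" "iso_type (induced R B) \<in> age R" using A B by (auto simp: age_def)
  from inex[unfolded inexhaustible_def, rule_format, OF this induced_mem_iso_type[OF R] induced_mem_iso_type[OF R]]
  obtain \<upsilon> U f g where U: "\<upsilon> \<in> age R" "U \<in> \<upsilon>" and f: "embedding f (induced R A) U"
    and g: "embedding g (induced R B) U" and disj: "f ` A \<inter> g ` B = {}" by auto
  \<comment> \<open>The structure \<open>U\<close> given by inexhaustibility need not lie inside
    \<open>R\<close>; an isomorphism \<open>h\<close> onto an induced substructure moves both
    disjoint images into \<open>R\<close>.\<close>
  obtain C where C: "C \<subseteq> univ R" "finite C" "\<upsilon> = iso_type (induced R C)" using U(1) by (auto simp: age_def)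
  then have "isomorphic U (induced R C)" using U(2) by (auto simp: iso_type_def intro: isomorphic_sym)
  then obtain h where h: "embedding h U (induced R C)" unfolding isomorphic_def by blast
  have hf: "embedding (h \<circ> f) (induced R A) (induced R C)" and hg: "embedding (h \<circ> g) (induced R B) (induced R C)"
    using embedding_compose f g h by blast+
  have sub: "(h \<circ> f) ` A \<subseteq> C" "(h \<circ> g) ` B \<subseteq> C" using embeddingD(3)[OF hf] embeddingD(3)[OF hg] by simp_all
  have "h ` (f ` A) \<inter> h ` (g ` B) = h ` (f ` A \<inter> g ` B)"
    by (rule inj_on_image_Int[OF embeddingD(2)[OF h], symmetric])
      (use embeddingD(3)[OF f] embeddingD(3)[OF g] in simp_all)
  then have "(h \<circ> f) ` A \<inter> (h \<circ> g) ` B = {}" using disj by (simp add: image_comp)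
  moreover have "iso_type (induced R ((h \<circ> f) ` A)) = iso_type (induced R A)"
    "iso_type (induced R ((h \<circ> g) ` B)) = iso_type (induced R B)"
    using embedding_image_isomorphic[OF hf order_refl] embedding_image_isomorphic[OF hg order_refl]
    by (simp_all add: iso_type_eq_iff[OF R] isomorphic_sym)
  ultimately show "\<exists>A' B'. A' \<subseteq> univ R \<and> finite A' \<and> B' \<subseteq> univ R \<and> finite B' \<and> A' \<inter> B' = {} \<and>
      iso_type (induced R A') = iso_type (induced R A) \<and> iso_type (induced R B') = iso_type (induced R B)"
    using sub C A B by (intro exI[of _ "(h \<circ> f) ` A"] exI[of _ "(h \<circ> g) ` B"]) auto
next
  show "finite {iso_type (induced R A) |A. A \<subseteq> univ R \<and> finite A \<and> card A = n}" for n by (rule fin)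
qed

text \<open>Polynomial growth controls only large sizes; this carries finiteness of the number of
  types down to the small ones.\<close>

lemma finite_iso_types_mono:
  assumes R: "relational_structure R" and inf: "infinite (univ R)" and "n \<le> m"
    and fin: "finite {iso_type (induced R A) |A. A \<subseteq> univ R \<and> finite A \<and> card A = m}" (is "finite ?T")
  shows "finite {iso_type (induced R A) |A. A \<subseteq> univ R \<and> finite A \<and> card A = n}"
proof -
  have "\<forall>\<sigma>\<in>?T. \<exists>A. finite A \<and> iso_type (induced R A) = \<sigma>" by auto
  from bchoice[OF this] obtain rep where
    rep: "\<forall>\<sigma>\<in>?T. finite (rep \<sigma>) \<and> iso_type (induced R (rep \<sigma>)) = \<sigma>" by blast
  have "{iso_type (induced R A) |A. A \<subseteq> univ R \<and> finite A \<and> card A = n}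
      \<subseteq> (\<lambda>X. iso_type (induced R X)) ` (\<Union>\<sigma>\<in>?T. Pow (rep \<sigma>))"
  proof clarify
    \<comment> \<open>a set of size \<open>n\<close> extends to one of size \<open>m\<close>, so its type is a restriction of one of the finitely many types of size \<open>m\<close>\<close>
    fix A assume A: "A \<subseteq> univ R" "finite A" "n = card A"
    have "infinite (univ R - A)" using inf A(2) by simp
    then obtain A' where A': "finite A'" "card A' = m - n" "A' \<subseteq> univ R - A"
      using infinite_arbitrarily_large by blast
    then have "card (A \<union> A') = m" using A \<open>n \<le> m\<close> by (subst card_Un_disjoint) auto
    then have \<sigma>: "iso_type (induced R (A \<union> A')) \<in> ?T" using A A' by auto
    let ?B = "rep (iso_type (induced R (A \<union> A')))"
    have "isomorphic (induced R (A \<union> A')) (induced R ?B)"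
      using bspec[OF rep \<sigma>] by (simp add: iso_type_eq_iff[OF R, symmetric])
    then obtain h where h: "embedding h (induced R (A \<union> A')) (induced R ?B)" unfolding isomorphic_def by blast
    have "isomorphic (induced R A) (induced R (h ` A))" by (rule embedding_image_isomorphic[OF h]) simp
    then have "iso_type (induced R A) = iso_type (induced R (h ` A))" by (simp add: iso_type_eq_iff[OF R])
    moreover have "h ` A \<subseteq> ?B" using embeddingD(3)[OF h] by auto
    ultimately show "iso_type (induced R A) \<in> (\<lambda>X. iso_type (induced R X)) ` (\<Union>\<sigma>\<in>?T. Pow (rep \<sigma>))"
      using \<sigma> by blast
  qed
  moreover have "finite (\<Union>\<sigma>\<in>?T. Pow (rep \<sigma>))" using fin rep by (intro finite_UN_I) auto
  ultimately show ?thesis by (meson finite_imageI finite_subset)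
qed

theorem mainTheorem4:
  fixes R :: "('a, 'i) rel_struct" and k :: nat
  assumes "relational_structure R"
    and "inexhaustible (age R)"
    and "polynomial_growth (profile R) k"
  shows "\<forall>n. profile R n \<le> enat ((n + k) choose k)"
proof
  fix n
  let ?T = "\<lambda>n. {iso_type (induced R A) |A. A \<subseteq> univ R \<and> finite A \<and> card A = n}"
  from assms(3) obtain a \<beta> N where a: "a > 0" and \<beta>: "\<beta> > 0"
    and lower: "\<And>m. m \<ge> N \<Longrightarrow> ereal (a * real m ^ k) \<le> ereal_of_enat (profile R m)"
    and upper: "\<And>m. m \<ge> N \<Longrightarrow> ereal_of_enat (profile R m) \<le> ereal (\<beta> * real m ^ k)"
    unfolding polynomial_growth_def eventually_sequentially by blast
  \<comment> \<open>The real upper bound excludes the value \<open>\<infinity>\<close> of the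
    profile.\<close>
  have fin: "finite (?T m)" if "m \<ge> N" for m
    using upper[OF that] by (auto simp: profile_def Let_def split: if_splits)
  have le: "real (card (?T m)) \<le> \<beta> * real m ^ k" if "m \<ge> N" for m
    using upper[OF that] fin[OF that] by (simp add: profile_def Let_def)
  \<comment> \<open>The lower bound makes the profile positive, so \<open>R\<close> has finite
    subsets of every large size and is infinite. Starting at \<open>Suc N\<close> ensures
    \<open>m > 0\<close> and thus \<open>m ^ k > 0\<close>.\<close>
  have "?T m \<noteq> {}" if "m \<ge> Suc N" for m
  proof
    assume "?T m = {}"
    then have "profile R m = 0" by (simp only: profile_def Let_def) (simp add: zero_enat_def)
    then have "a * real m ^ k \<le> 0" using lower[of m] that by (simp add: zero_ereal_def)
    moreover have "0 < a * real m ^ k" using a that by simp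
    ultimately show False by simp
  qed
  then have large: "\<exists>A. A \<subseteq> univ R \<and> finite A \<and> card A = m" if "m \<ge> Suc N" for m using that by blast
  have inf: "infinite (univ R)"
  proof
    assume f: "finite (univ R)"
    obtain A where "A \<subseteq> univ R" "card A = Suc N + card (univ R)" using large[of "Suc N + card (univ R)"] by auto
    with card_mono[OF f, of A] show False by simp
  qed
  have finT: "finite (?T m)" for m
    by (rule finite_iso_types_mono[OF assms(1) inf, of m "max m N"]) (use fin[of "max m N"] in simp_all)
  interpret inexhaustible_types "univ R" "\<lambda>A. iso_type (induced R A)"
    by (rule relational_structure_inexhaustible_types[OF assms(1,2) finT])
  have "card (?T n) \<le> (n + k) choose k"
    using card_types_le_choose[of N \<beta> k n] le \<beta> unfolding types_def by simp
  then show "profile R n \<le> enat ((n + k) choose k)" using finT by (simp add: profile_def Let_def)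
qed

end
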